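(* Let $p\ge 2$, let $U$ be uniformly distributed on the unit sphere $\mathbb S^{p-1}\subset\mathbb R^p$, let $a_1,\dots,a_k\in\mathbb R^p\setminus\{0\}$ be any finite collection of nonzero vectors (no spanning, independence or general-position hypothesis), and let $w_1,\dots,w_k\ge 0$ with $\sum_j w_j=1$. Then $$H_{a,w}(U)=\{U^\top N_{a,w}(U)\}^2\sim\mathrm{Beta}\Bigl(\tfrac12,\tfrac{p-1}{2}\Bigr).$$ In particular the distribution is independent of $k$, of the locations of and linear relations among the $a_j$, and of the weights $w$.
   Context: For $u\in\mathbb S^{p-1}$ outside the Haar-null set $\bigcup_{j:w_j>0}\{u: a_j^\top u=0\}$ define $$g_{a,w}(u)=\sum_{j:w_j>0}w_j\frac{a_j}{a_j^\top u},\qquad N_{a,w}(u)=\frac{g_{a,w}(u)}{\|g_{a,w}(u)\|},\qquad H_{a,w}(u)=\frac1{\|g_{a,w}(u)\|^2}.$$ Since $u^\top g_{a,w}(u)=\sum_j w_j=1$, one has $g_{a,w}(u)\ne0$, so these are well defined. *)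

theory Defs
  imports "HOL-Probability.Probability"
begin

text \<open>
  Normalised surface measure on the unit sphere, by polar coordinates: the mass of a Borel set
  \<open>A\<close> is the Lebesgue volume of the part of the unit ball lying over \<open>A\<close>, divided by the volume
  of the ball (\<open>sgn x = x /\<^sub>R norm x\<close>).  The lemmas below confirm that it is a rotation-invariant
  Borel probability measure carried by the sphere, hence the Haar measure of the sphere.
  It lives on the Borel sets of the ambient space.
\<close>
definition sphere_uniform :: "'a::euclidean_space measure" where
  "sphere_uniform = distr (uniform_measure lborel (ball 0 1)) borel sgn"

definition beta_density :: "real \<Rightarrow> real \<Rightarrow> real \<Rightarrow> real" where
  "beta_density \<alpha> \<beta> x =
     (if 0 < x \<and> x < 1 then x powr (\<alpha> - 1) * (1 - x) powr (\<beta> - 1) / Beta \<alpha> \<beta> else 0)"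

definition exceptional_set :: "nat \<Rightarrow> (nat \<Rightarrow> real ^ 'n) \<Rightarrow> (nat \<Rightarrow> real) \<Rightarrow> (real ^ 'n) set" where
  "exceptional_set k a w = (\<Union>j\<in>{j\<in>{1..k}. w j > 0}. {u\<in>sphere 0 1. a j \<bullet> u = 0})"

text \<open>
  On the exceptional set the next three functions take meaningless values, since \<open>x / 0 = 0\<close>.
\<close>
definition g_field :: "nat \<Rightarrow> (nat \<Rightarrow> real ^ 'n) \<Rightarrow> (nat \<Rightarrow> real) \<Rightarrow> real ^ 'n \<Rightarrow> real ^ 'n" where
  "g_field k a w u = (\<Sum>j\<in>{j\<in>{1..k}. w j > 0}. w j *\<^sub>R (a j /\<^sub>R (a j \<bullet> u)))"

definition N_field :: "nat \<Rightarrow> (nat \<Rightarrow> real ^ 'n) \<Rightarrow> (nat \<Rightarrow> real) \<Rightarrow> real ^ 'n \<Rightarrow> real ^ 'n" where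
  "N_field k a w u = g_field k a w u /\<^sub>R norm (g_field k a w u)"

definition H_fun :: "nat \<Rightarrow> (nat \<Rightarrow> real ^ 'n) \<Rightarrow> (nat \<Rightarrow> real) \<Rightarrow> real ^ 'n \<Rightarrow> real" where
  "H_fun k a w u = 1 / (norm (g_field k a w u))\<^sup>2"

lemma prob_space_sphere_uniform: "prob_space (sphere_uniform :: 'a::euclidean_space measure)"
proof -
  have "emeasure lborel (ball 0 1 :: 'a set) \<noteq> 0"
    using content_ball_pos[of 1 "0::'a"] by (auto simp: measure_def)
  moreover have "emeasure lborel (ball 0 1 :: 'a set) \<noteq> \<infinity>"
    using emeasure_lborel_ball_finite[of "0::'a" 1] by simp
  ultimately have "prob_space (uniform_measure lborel (ball 0 1 :: 'a set))"
    by (rule prob_space_uniform_measure)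
  then show ?thesis
    unfolding sphere_uniform_def
    by (rule prob_space.prob_space_distr) (simp add: sgn_div_norm)
qed

lemma AE_sphere_uniform: "AE u in (sphere_uniform :: 'a::euclidean_space measure). u \<in> sphere 0 1"
proof -
  have "AE x in (lborel :: 'a measure). x \<noteq> 0"
    by (rule AE_lborel_singleton)
  then have "AE x in uniform_measure lborel (ball 0 1 :: 'a set). x \<noteq> 0"
    by (intro AE_uniform_measureI) auto
  then have "AE x in uniform_measure lborel (ball 0 1 :: 'a set). sgn x \<in> sphere 0 1"
    by eventually_elim (simp add: norm_sgn)
  then show ?thesis
    unfolding sphere_uniform_def by (subst AE_distr_iff) (simp_all add: sgn_div_norm)
qed

text \<open>
  \<open>T\<close> preserves the volume of balls, hence by Vitali's covering theorem it does not decrease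
  the measure of open sets; neither does its inverse.
\<close>
lemma emeasure_orthogonal_vimage_ge:
  fixes T :: "'a::euclidean_space \<Rightarrow> 'a"
  assumes T: "orthogonal_transformation T" and G: "open G"
  shows "emeasure lborel G \<le> emeasure lborel (T -` G)"
proof -
  have ball: "emeasure lborel (T -` cball x r) = emeasure lborel (cball x r)" for x r
  proof -
    obtain y where y: "x = T y"
      using orthogonal_transformation_surj[OF T] by (metis surjD)
    have "T -` cball x r = cball y r"
      using T by (auto simp: y dist_norm orthogonal_transformation_norm linear_diff[symmetric]
          orthogonal_transformation_linear)
    then show ?thesis
      by (cases "r \<ge> 0") (simp_all add: emeasure_cball)
  qed
  have [measurable]: "T \<in> borel_measurable borel"
    using T by (intro borel_measurable_continuous_onI linear_continuous_on)
      (simp add: orthogonal_transformation_linear linear_conv_bounded_linear[symmetric])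
  let ?K = "{(x, r). x \<in> G \<and> 0 < r \<and> cball x r \<subseteq> G}"
  obtain C where C: "countable C" "C \<subseteq> ?K"
      "pairwise (\<lambda>i j. disjnt (cball (fst i) (snd i)) (cball (fst j) (snd j))) C"
      "negligible (G - (\<Union>i\<in>C. cball (fst i) (snd i)))"
  proof (rule Vitali_covering_theorem_cballs[of ?K snd G fst])
    show "\<And>i. i \<in> ?K \<Longrightarrow> 0 < snd i" by auto
  next
    fix x d :: real and y :: 'a
    assume y: "y \<in> G" and d: "0 < d"
    obtain e where e: "e > 0" "cball y e \<subseteq> G"
      using G y open_contains_cball by blast
    have "(y, min e (d / 2)) \<in> ?K"
      using y d e by auto
    then show "\<exists>i. i \<in> ?K \<and> y \<in> cball (fst i) (snd i) \<and> snd i < d"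
      using d e by (intro exI[of _ "(y, min e (d / 2))"]) auto
  qed (use that in blast)
  define B where "B i = cball (fst i) (snd i)" for i :: "'a \<times> real"
  have disj: "disjoint_family_on B C"
    using C(3) by (auto simp: disjoint_family_on_def pairwise_def disjnt_def B_def)
  have meas [measurable]: "B i \<in> sets borel" "G \<in> sets borel" for i
    using G by (auto simp: B_def)
  have UB: "(\<Union>i\<in>C. B i) \<in> sets borel"
    using C(1) by (intro sets.countable_UN') auto
  have sub: "(\<Union>i\<in>C. B i) \<subseteq> G"
    using C(2) unfolding B_def by (fastforce simp del: mem_cball)
  have "emeasure lborel (G - (\<Union>i\<in>C. B i)) = 0"
    using C(4) UB by (simp add: B_def negligible_iff_null_sets null_sets_def)
  then have "emeasure lborel G = emeasure lborel (\<Union>i\<in>C. B i)"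
    using sub UB emeasure_Diff_null_set[of "G - (\<Union>i\<in>C. B i)" lborel G]
    by (simp add: null_sets_def Diff_Diff_Int inf.absorb2)
  also have "\<dots> = (\<integral>\<^sup>+i. emeasure lborel (B i) \<partial>count_space C)"
    using C(1) disj by (intro emeasure_UN_countable) auto
  also have "\<dots> = (\<integral>\<^sup>+i. emeasure lborel (T -` B i) \<partial>count_space C)"
    by (simp add: B_def ball)
  also have "\<dots> = emeasure lborel (\<Union>i\<in>C. T -` B i)"
  proof (rule emeasure_UN_countable[symmetric])
    show "\<And>i. i \<in> C \<Longrightarrow> T -` B i \<in> sets lborel"
      using measurable_sets[of T borel borel] by simp
    show "disjoint_family_on (\<lambda>i. T -` B i) C"
      using disj unfolding disjoint_family_on_def by blast
  qed fact
  also have "\<dots> \<le> emeasure lborel (T -` G)"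
    using sub measurable_sets[of T borel borel G] by (intro emeasure_mono) auto
  finally show ?thesis .
qed

lemma lborel_distr_orthogonal:
  fixes T :: "'a::euclidean_space \<Rightarrow> 'a"
  assumes T: "orthogonal_transformation T"
  shows "distr lborel borel T = lborel"
proof (rule lborel_eqI[symmetric])
  have cont: "continuous_on UNIV S" if "orthogonal_transformation S" for S :: "'a \<Rightarrow> 'a"
    using that by (intro linear_continuous_on)
      (simp add: orthogonal_transformation_linear linear_conv_bounded_linear[symmetric])
  fix l u :: 'a
  assume lu: "\<And>b. b \<in> Basis \<Longrightarrow> l \<bullet> b \<le> u \<bullet> b"
  have "open (T -` box l u)"
    using cont[OF T] by (intro open_vimage) auto
  then have "emeasure lborel (T -` box l u) \<le> emeasure lborel (inv T -` (T -` box l u))"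
    by (intro emeasure_orthogonal_vimage_ge orthogonal_transformation_inv T)
  also have "inv T -` (T -` box l u) = box l u"
    using orthogonal_transformation_surj[OF T] by (auto simp: surj_f_inv_f)
  finally have "emeasure lborel (T -` box l u) = emeasure lborel (box l u)"
    using emeasure_orthogonal_vimage_ge[OF T, of "box l u"] by (intro antisym) auto
  then show "emeasure (distr lborel borel T) (box l u) = (\<Prod>b\<in>Basis. (u - l) \<bullet> b)"
    using lu by (subst emeasure_distr) (auto intro: borel_measurable_continuous_onI cont T)
qed simp

lemma sphere_uniform_orthogonal:
  fixes T :: "'a::euclidean_space \<Rightarrow> 'a"
  assumes T: "orthogonal_transformation T"
  shows "distr sphere_uniform borel T = sphere_uniform"
proof -
  have lin: "linear T" and norm: "norm (T x) = norm x" for x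
    using T by (simp_all add: orthogonal_transformation_linear orthogonal_transformation_norm)
  have [measurable]: "T \<in> borel_measurable borel"
    using lin by (intro borel_measurable_continuous_onI linear_continuous_on)
      (simp add: linear_conv_bounded_linear[symmetric])
  have [measurable]: "(sgn :: 'a \<Rightarrow> 'a) \<in> borel_measurable borel"
    by (simp add: sgn_div_norm)
  have T_sgn: "T \<circ> sgn = sgn \<circ> T"
    by (auto simp: fun_eq_iff sgn_div_norm norm linear_cmul[OF lin])
  have "distr (uniform_measure lborel (ball 0 1)) borel T = uniform_measure lborel (ball 0 1)"
  proof (rule measure_eqI)
    fix A :: "'a set" assume "A \<in> sets (distr (uniform_measure lborel (ball 0 1)) borel T)"
    then have A [measurable]: "A \<in> sets borel" by simp
    have TA: "T -` A \<in> sets borel"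
      using measurable_sets[of T borel borel A] by simp
    have "emeasure lborel (ball 0 1 \<inter> T -` A) = emeasure lborel (T -` (ball 0 1 \<inter> A))"
      by (rule arg_cong[where f = "emeasure lborel"]) (auto simp: norm)
    also have "\<dots> = emeasure (distr lborel borel T) (ball 0 1 \<inter> A)"
      by (subst emeasure_distr) auto
    also have "\<dots> = emeasure lborel (ball 0 1 \<inter> A)"
      by (simp add: lborel_distr_orthogonal[OF T])
    finally show "emeasure (distr (uniform_measure lborel (ball 0 1)) borel T) A =
        emeasure (uniform_measure lborel (ball 0 1)) A"
      using TA by (subst emeasure_distr) auto
  qed simp
  then have "sphere_uniform = distr (distr (uniform_measure lborel (ball 0 1)) borel T) borel sgn"
    by (simp add: sphere_uniform_def)
  also have "\<dots> = distr sphere_uniform borel T"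
    unfolding sphere_uniform_def by (simp add: distr_distr T_sgn)
  finally show ?thesis ..
qed

end

theory Submission
  imports Defs "HOL-Complex_Analysis.Cauchy_Integral_Formula"
begin

text \<open>
  Write \<open>g\<close> for the field \<open>y \<mapsto> \<Sum>j. w j *\<^sub>R (a j /\<^sub>R (a j \<bullet> y))\<close> on \<open>\<real>\<^sup>p\<close> and \<open>h y = 1 / (norm (g y))\<^sup>2\<close>, so that
  \<open>H_fun\<close> is the restriction of \<open>h\<close> to the sphere.  The uniform point \<open>U\<close> is replaced by a standard
  Gaussian vector \<open>Y\<close>, and an independent standard Gaussian vector \<open>X\<close> is added.

  The heart of the matter is that \<open>g Y \<bullet> X = (\<Sum>j. w j * ((a j \<bullet> X) / (a j \<bullet> Y)))\<close> has the standard Cauchy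
  law whatever \<open>a\<close> and \<open>w\<close> are (\<open>char_log_gradient_Cauchy\<close>).  The law of \<open>(X, Y)\<close> does not change when
  all the planes spanned by corresponding coordinates of \<open>X\<close> and \<open>Y\<close> are rotated by the same angle
  \<open>\<theta>\<close>.  Such a rotation adds \<open>\<theta>\<close> to the polar angle \<open>\<phi> j\<close> of each point \<open>(a j \<bullet> Y, a j \<bullet> X)\<close>, so one may
  average over \<open>\<theta>\<close> and study \<open>\<Sum>j. w j * tan (\<phi> j + \<theta>)\<close> for fixed angles \<open>\<phi> j\<close>.  Now \<open>\<i> * tan \<alpha>\<close> is minus
  the Cayley transform \<open>(1 - q) / (1 + q)\<close> at \<open>q = exp (2 * \<i> * \<alpha>)\<close>, and the Cayley transform maps the
  unit disc into the right half plane.  Hence \<open>exp (\<i> * s * (\<Sum>j. w j * tan (\<phi> j + \<theta>)))\<close> is the boundary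
  value of a bounded holomorphic function on the disc, and its mean is the value \<open>exp (- s)\<close> at the
  centre (\<open>integral_Cayley_phases\<close>).

  Given \<open>Y\<close>, the variable \<open>g Y \<bullet> X\<close> is centred normal with variance \<open>(norm (g Y))\<^sup>2\<close>, so the expectation of
  \<open>exp (- (s * norm (g Y))\<^sup>2 / 2)\<close> is \<open>exp (- s)\<close>.  Integration against \<open>s ^ (2 * n - 1)\<close> turns this
  Laplace transform into the moments of \<open>h Y\<close> (\<open>gaussian_moment_inverse_norm_log_gradient\<close>).  As \<open>h\<close>
  is homogeneous of degree two and the norm of \<open>Y\<close> is independent of its direction, division by the
  moments of \<open>(norm Y)\<^sup>2\<close> gives the moments of \<open>h U\<close>
  (\<open>sphere_moment_inverse_norm_log_gradient\<close>).  They are those of the beta distribution, and a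
  distribution on the unit interval is determined by its moments
  (\<open>real_distribution_eq_if_moments_eq\<close>).
\<close>

section \<open>Mean values on the unit circle\<close>

abbreviation unit_interval :: "real measure" where
  "unit_interval \<equiv> uniform_measure lborel {0..1}"

lemma prob_space_unit_interval: "prob_space unit_interval"
  by (rule prob_space_uniform_measure) auto

lemma integral_unit_interval:
  fixes f :: "real \<Rightarrow> complex"
  assumes [measurable]: "f \<in> borel_measurable borel"
  shows "(\<integral>x. f x \<partial>unit_interval) = (LINT x:{0..1}|lborel. f x)"
proof -
  have "uniform_measure lborel {0..1::real} = density lborel (\<lambda>x. ennreal (indicator {0..1} x))"
    unfolding uniform_measure_def by (intro density_cong) (auto simp: indicator_def)
  then show ?thesis
    unfolding set_lebesgue_integral_def by (simp add: integral_density)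
qed

lemma has_integral_circle_mean:
  fixes F :: "complex \<Rightarrow> complex"
  assumes F: "F holomorphic_on ball 0 1" and r: "0 < r" "r < 1"
  shows "((\<lambda>x. F (of_real r * cis (2 * pi * x))) has_integral F 0) {0..1}"
proof -
  have "((\<lambda>u. F u / (u - 0)) has_contour_integral (2 * of_real pi * \<i> * F 0)) (circlepath 0 r)"
  proof (rule Cauchy_integral_circlepath)
    show "continuous_on (cball 0 r) F"
      using r by (intro holomorphic_on_imp_continuous_on holomorphic_on_subset[OF F]) auto
    show "F holomorphic_on ball 0 r"
      using r by (intro holomorphic_on_subset[OF F]) auto
  qed (use r in auto)
  then have "((\<lambda>x. F (circlepath 0 r x) / circlepath 0 r x * vector_derivative (circlepath 0 r) (at x))
      has_integral (2 * of_real pi * \<i> * F 0)) {0..1}"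
    by (simp add: has_contour_integral)
  also have "(\<lambda>x. F (circlepath 0 r x) / circlepath 0 r x * vector_derivative (circlepath 0 r) (at x))
      = (\<lambda>x. F (of_real r * cis (2 * pi * x)) * (2 * of_real pi * \<i>))"
    using r by (auto simp: vector_derivative_circlepath fun_eq_iff) (simp add: circlepath cis_conv_exp mult_ac)
  finally have "((\<lambda>x. F (of_real r * cis (2 * pi * x)) * (2 * of_real pi * \<i>) * inverse (2 * of_real pi * \<i>))
      has_integral (2 * of_real pi * \<i> * F 0) * inverse (2 * of_real pi * \<i>)) {0..1}"
    by (rule has_integral_mult_left)
  then show ?thesis
    by (simp add: field_simps)
qed

lemma integral_circle_mean:
  fixes F :: "complex \<Rightarrow> complex"
  assumes F: "F holomorphic_on ball 0 1" and r: "0 < r" "r < 1"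
  shows "(LINT x:{0..1}|lborel. F (of_real r * cis (2 * pi * x))) = F 0"
proof -
  have "continuous_on {0..1} (\<lambda>x. F (of_real r * cis (2 * pi * x)))"
    using r by (intro continuous_on_compose2[OF holomorphic_on_imp_continuous_on[OF F]] continuous_intros)
      (auto simp: norm_mult)
  then have "set_integrable lborel {0..1} (\<lambda>x. F (of_real r * cis (2 * pi * x)))"
    unfolding set_integrable_def by (intro borel_integrable_compact) auto
  then show ?thesis
    using has_integral_circle_mean[OF F r]
    by (simp add: set_borel_integral_eq_integral(2) integral_unique)
qed

text \<open>
  Dominated convergence along the radii: the mean over the circle of radius \<open>r\<close> is \<open>F 0\<close> for every
  \<open>r < 1\<close>, so a bounded \<open>F\<close> needs radial limits only almost everywhere on the unit circle.
\<close>
lemma integral_boundary_mean: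
  fixes F :: "complex \<Rightarrow> complex" and f :: "real \<Rightarrow> complex"
  assumes F: "F holomorphic_on ball 0 1" and bound: "\<And>z. norm z < 1 \<Longrightarrow> norm (F z) \<le> B"
    and f [measurable]: "f \<in> borel_measurable borel"
    and lim: "AE x in lborel. ((\<lambda>r. F (of_real r * cis (2 * pi * x))) \<longlongrightarrow> f x) (at_left 1)"
  shows "(\<integral>x. f x \<partial>unit_interval) = F 0"
proof -
  \<comment> \<open>the offset 2 makes all the radii positive\<close>
  define r where "r n = 1 - inverse (real (Suc (Suc n)))" for n
  have r: "0 < r n" "r n < 1" for n
    using inverse_less_1_iff[of "real (Suc (Suc n))"] by (auto simp: r_def)
  have "r \<longlonglongrightarrow> 1 - 0"
    unfolding r_def by (rule tendsto_diff[OF tendsto_const LIMSEQ_Suc[OF LIMSEQ_inverse_real_of_nat]])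
  then have r_lim: "filterlim r (at_left 1) sequentially"
    using r by (auto simp: filterlim_at less_imp_neq)
  from lim have lim': "AE x in lborel. (\<lambda>n. F (of_real (r n) * cis (2 * pi * x))) \<longlonglongrightarrow> f x"
    by eventually_elim (rule filterlim_compose[OF _ r_lim])
  have "(\<lambda>n. LINT x:{0..1}|lborel. F (of_real (r n) * cis (2 * pi * x)))
      \<longlonglongrightarrow> (LINT x:{0..1}|lborel. f x)"
    unfolding set_lebesgue_integral_def
  proof (rule integral_dominated_convergence[where w = "\<lambda>x. B * indicator {0..1} x"])
    show "(\<lambda>x. indicator {0..1} x *\<^sub>R F (complex_of_real (r n) * cis (2 * pi * x))) \<in> borel_measurable lborel" for n
    proof -
      have "continuous_on UNIV (\<lambda>x. F (complex_of_real (r n) * cis (2 * pi * x)))"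
        using r[of n] by (intro continuous_on_compose2[OF holomorphic_on_imp_continuous_on[OF F]] continuous_intros)
          (auto simp: norm_mult)
      then have "(\<lambda>x. F (complex_of_real (r n) * cis (2 * pi * x))) \<in> borel_measurable borel"
        by (rule borel_measurable_continuous_onI)
      then show ?thesis by measurable
    qed
    show "AE x in lborel. (\<lambda>n. indicator {0..1} x *\<^sub>R F (complex_of_real (r n) * cis (2 * pi * x)))
        \<longlonglongrightarrow> indicator {0..1} x *\<^sub>R f x"
      using lim' by eventually_elim (auto intro: tendsto_intros)
    show "AE x in lborel. norm (indicator {0..1} x *\<^sub>R F (complex_of_real (r n) * cis (2 * pi * x)))
        \<le> B * indicator {0..1} x" for n
    proof (rule AE_I2)
      fix x :: real
      have "norm (F (complex_of_real (r n) * cis (2 * pi * x))) \<le> B"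
        using r[of n] by (intro bound) (simp add: norm_mult)
      then show "norm (indicator {0..1} x *\<^sub>R F (complex_of_real (r n) * cis (2 * pi * x)))
        \<le> B * indicator {0..1} x"
        by (auto simp: indicator_def)
    qed
  qed (auto intro!: integrable_mult_right)
  then have "(\<lambda>n. F 0) \<longlonglongrightarrow> (LINT x:{0..1}|lborel. f x)"
    by (simp add: integral_circle_mean[OF F r])
  then have "(LINT x:{0..1}|lborel. f x) = F 0"
    by (simp add: LIMSEQ_const_iff)
  then show ?thesis by (simp add: integral_unit_interval)
qed

text \<open>
  Two points with the same image differ by an integer, so each fibre is countable.
\<close>
lemma AE_cis_neq: "AE x in lborel. cis (2 * pi * x) \<noteq> c"
proof (cases "\<exists>x0. cis (2 * pi * x0) = c")
  case True
  then obtain x0 where x0: "cis (2 * pi * x0) = c" by blast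
  have "{x. cis (2 * pi * x) = c} \<subseteq> range (\<lambda>n::int. x0 + of_int n)"
  proof
    fix x assume "x \<in> {x. cis (2 * pi * x) = c}"
    then have "exp (\<i> * complex_of_real (2 * pi * x)) = exp (\<i> * complex_of_real (2 * pi * x0))"
      using x0 by (simp add: cis_conv_exp)
    then obtain n :: int where
      "\<i> * complex_of_real (2 * pi * x) = \<i> * complex_of_real (2 * pi * x0) + (of_int (2 * n) * pi) * \<i>"
      unfolding exp_eq by blast
    then have "pi * (2 * x) = pi * (2 * (x0 + of_int n))"
      by (auto simp: complex_eq_iff algebra_simps)
    then have "x = x0 + of_int n"
      by (subst (asm) mult_left_cancel) auto
    then show "x \<in> range (\<lambda>n::int. x0 + of_int n)" by blast
  qed
  then have "countable {x. cis (2 * pi * x) = c}"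
    by (rule countable_subset) simp
  then have "{x. cis (2 * pi * x) = c} \<in> null_sets lborel"
    by (rule countable_imp_null_set_lborel)
  then show ?thesis
    by (rule AE_I'[of _ lborel]) auto
next
  case False
  then show ?thesis by auto
qed

text \<open>
  The Cayley transform maps the unit disc into the right half plane; this is what keeps the
  exponential in the next lemma bounded.
\<close>
lemma Re_Cayley_nonneg:
  fixes z :: complex
  assumes "norm z < 1"
  shows "0 \<le> Re ((1 - z) / (1 + z))"
proof -
  have "(Re z)\<^sup>2 + (Im z)\<^sup>2 \<le> 1"
    using assms by (simp add: cmod_power2[symmetric] power_le_one)
  moreover have "0 \<le> (Re (1 + z))\<^sup>2 + (Im (1 + z))\<^sup>2"
    by simp
  ultimately show ?thesis
    unfolding Re_divide by (intro divide_nonneg_nonneg) (simp_all add: power2_eq_square algebra_simps)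
qed

text \<open>
  On the unit circle \<open>(1 - q) / (1 + q) = - \<i> * tan \<alpha>\<close> for \<open>q = cis (2 * \<alpha>)\<close>, so the integrand is
  \<open>exp (\<i> * s * S)\<close> for a weighted sum \<open>S\<close> of tangents with phases that are shifted together, and
  the lemma says that \<open>S\<close> has the standard Cauchy law.  At the centre of the disc every
  Cayley transform equals 1, whence the value \<open>exp (- s)\<close>.
\<close>
lemma integral_Cayley_phases:
  fixes J :: "'i set" and u :: "'i \<Rightarrow> complex" and w :: "'i \<Rightarrow> real"
  assumes J: "finite J" and w: "\<And>j. j \<in> J \<Longrightarrow> 0 \<le> w j" "sum w J = 1"
    and u: "\<And>j. j \<in> J \<Longrightarrow> norm (u j) = 1" and s: "0 \<le> s"
  shows "(\<integral>x. exp (- of_real s * (\<Sum>j\<in>J. of_real (w j) *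
      ((1 - u j * cis (2 * pi * x)) / (1 + u j * cis (2 * pi * x))))) \<partial>unit_interval) = exp (- of_real s)"
proof -
  define F where "F z = exp (- of_real s * (\<Sum>j\<in>J. of_real (w j) * ((1 - u j * z) / (1 + u j * z))))" for z
  have nz: "1 + u j * z \<noteq> 0" if "j \<in> J" "norm z < 1" for j z
  proof
    assume "1 + u j * z = 0"
    then have "u j * z = - 1" by (simp add: add_eq_0_iff)
    then have "norm (u j * z) = 1" by simp
    then show False using that u[of j] by (simp add: norm_mult)
  qed
  have hol: "F holomorphic_on ball 0 1"
    unfolding F_def by (intro holomorphic_intros) (auto simp: nz)
  have bound: "norm (F z) \<le> 1" if "norm z < 1" for z
  proof -
    have "0 \<le> (\<Sum>j\<in>J. w j * Re ((1 - u j * z) / (1 + u j * z)))"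
      using that u w by (intro sum_nonneg mult_nonneg_nonneg Re_Cayley_nonneg) (auto simp: norm_mult)
    then have "Re (of_real s * (\<Sum>j\<in>J. of_real (w j) * ((1 - u j * z) / (1 + u j * z)))) \<ge> 0"
      using s by (simp add: Re_sum del: times_divide_eq_right)
    then show ?thesis by (simp add: F_def)
  qed
  have "(\<integral>x. F (cis (2 * pi * x)) \<partial>unit_interval) = F 0"
  proof (rule integral_boundary_mean[OF hol bound])
    show "(\<lambda>x. F (cis (2 * pi * x))) \<in> borel_measurable borel"
      unfolding F_def cis_conv_exp by measurable
    have "AE x in lborel. \<forall>j\<in>J. cis (2 * pi * x) \<noteq> - inverse (u j)"
      using J AE_cis_neq by (intro AE_finite_allI) auto
    then show "AE x in lborel. ((\<lambda>r. F (of_real r * cis (2 * pi * x))) \<longlongrightarrow> F (cis (2 * pi * x))) (at_left 1)"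
    proof eventually_elim
      case (elim x)
      have "1 + u j * cis (2 * pi * x) \<noteq> 0" if "j \<in> J" for j
      proof
        assume "1 + u j * cis (2 * pi * x) = 0"
        moreover have "u j \<noteq> 0" using u[OF that] by auto
        ultimately have "cis (2 * pi * x) = - inverse (u j)"
          by (simp add: field_simps add_eq_0_iff)
        then show False using elim that by blast
      qed
      then have "((\<lambda>r. F (of_real r * cis (2 * pi * x))) \<longlongrightarrow> F (of_real 1 * cis (2 * pi * x))) (at_left 1)"
        unfolding F_def by (intro tendsto_intros) auto
      then show ?case by simp
    qed
  qed auto
  then show ?thesis
    using w by (simp add: F_def of_real_sum[symmetric])
qed

section \<open>The standard Gaussian measure\<close>

definition std_gaussian :: "'a::euclidean_space measure" where
  "std_gaussian = density lborel (\<lambda>x. ennreal (exp (- (norm x)\<^sup>2 / 2) / sqrt (2 * pi) ^ DIM('a)))"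

lemma sets_std_gaussian [measurable_cong, simp]: "sets std_gaussian = sets borel"
  and space_std_gaussian [simp]: "space std_gaussian = UNIV"
  by (simp_all add: std_gaussian_def)

lemma norm_square_Basis:
  fixes x :: "'a::euclidean_space"
  shows "(norm x)\<^sup>2 = (\<Sum>b\<in>Basis. (x \<bullet> b)\<^sup>2)"
  unfolding power2_norm_eq_inner by (subst euclidean_inner) (simp add: power2_eq_square)

text \<open>
  In coordinates the density is that of independent standard normal variables; its form in terms of
  the norm, used in the definition, is what shows the rotation invariance.
\<close>
lemma gaussian_density_prod:
  fixes x :: "'a::euclidean_space"
  shows "exp (- (norm x)\<^sup>2 / 2) / sqrt (2 * pi) ^ DIM('a) = (\<Prod>b\<in>Basis. std_normal_density (x \<bullet> b))"
proof -
  have "exp (- (norm x)\<^sup>2 / 2) = (\<Prod>b\<in>Basis. exp (- (x \<bullet> b)\<^sup>2 / 2))"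
    by (simp add: norm_square_Basis exp_sum[symmetric] sum_negf sum_divide_distrib)
  then show ?thesis
    unfolding std_normal_density_def prod.distrib by (simp add: power_one_over)
qed

lemma prob_space_std_gaussian: "prob_space (std_gaussian :: 'a::euclidean_space measure)"
proof
  have "emeasure (std_gaussian :: 'a measure) UNIV
      = (\<integral>\<^sup>+x. ennreal (\<Prod>b\<in>Basis. std_normal_density (x \<bullet> b)) \<partial>(lborel :: 'a measure))"
    unfolding std_gaussian_def gaussian_density_prod by (subst emeasure_density) auto
  also have "\<dots> = (\<integral>\<^sup>+x. (\<Prod>b\<in>Basis. ennreal (std_normal_density (x \<bullet> b))) \<partial>(lborel :: 'a measure))"
    by (subst prod_ennreal) (auto simp: normal_density_nonneg)
  also have "\<dots> = (\<Prod>b\<in>(Basis::'a set). (\<integral>\<^sup>+x. ennreal (std_normal_density x) \<partial>lborel))"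
    by (rule nn_integral_lborel_prod) auto
  also have "\<dots> = 1"
    using prob_space.emeasure_space_1[OF prob_space_normal_density[of 1 0]]
    by (simp add: emeasure_density)
  finally show "emeasure (std_gaussian :: 'a measure) (space std_gaussian) = 1" by simp
qed

text \<open>
  Two independent Gaussian vectors form one Gaussian vector of the product space.  This makes
  orthogonal transformations that mix the two vectors available.
\<close>
lemma std_gaussian_pair:
  "(std_gaussian :: ('a::euclidean_space \<times> 'b::euclidean_space) measure) = std_gaussian \<Otimes>\<^sub>M std_gaussian"
proof -
  have sf: "sigma_finite_measure (std_gaussian :: 'b measure)"
    using prob_space_std_gaussian by (rule prob_space_imp_sigma_finite)
  have "(std_gaussian :: 'a measure) \<Otimes>\<^sub>M (std_gaussian :: 'b measure) = density (lborel \<Otimes>\<^sub>M lborel) (\<lambda>(x, y).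
      ennreal (exp (- (norm x)\<^sup>2 / 2) / sqrt (2 * pi) ^ DIM('a)) *
      ennreal (exp (- (norm y)\<^sup>2 / 2) / sqrt (2 * pi) ^ DIM('b)))"
    unfolding std_gaussian_def
    by (rule pair_measure_density) (use sf in \<open>auto simp: std_gaussian_def lborel.sigma_finite_measure_axioms\<close>)
  also have "\<dots> = std_gaussian"
    unfolding std_gaussian_def lborel_prod
    by (rule arg_cong[where f = "density lborel"])
      (auto simp: fun_eq_iff norm_Pair add_divide_distrib exp_add[symmetric] power_add ennreal_mult[symmetric])
  finally show ?thesis ..
qed

lemma distr_std_gaussian_orthogonal:
  fixes T :: "'a::euclidean_space \<Rightarrow> 'a"
  assumes T: "orthogonal_transformation T"
  shows "distr std_gaussian borel T = std_gaussian"
proof -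
  have [measurable]: "T \<in> borel_measurable borel"
    using T by (intro borel_measurable_continuous_onI linear_continuous_on)
      (simp add: orthogonal_transformation_linear linear_conv_bounded_linear[symmetric])
  define \<phi> :: "'a \<Rightarrow> ennreal" where "\<phi> x = ennreal (exp (- (norm x)\<^sup>2 / 2) / sqrt (2 * pi) ^ DIM('a))" for x
  have [measurable]: "\<phi> \<in> borel_measurable borel"
    unfolding \<phi>_def by measurable
  have "std_gaussian = density (distr lborel borel T) \<phi>"
    by (simp add: lborel_distr_orthogonal[OF T] std_gaussian_def \<phi>_def[abs_def])
  also have "\<dots> = distr (density lborel (\<lambda>x. \<phi> (T x))) borel T"
    by (subst density_distr) auto
  also have "(\<lambda>x. \<phi> (T x)) = \<phi>"
    using T by (simp add: \<phi>_def orthogonal_transformation_norm fun_eq_iff)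
  finally show ?thesis
    by (simp add: std_gaussian_def \<phi>_def[abs_def])
qed

lemma integral_lborel_prod:
  fixes f :: "'a::euclidean_space \<Rightarrow> real \<Rightarrow> 'c::{real_normed_field,banach,second_countable_topology}"
  assumes f: "\<And>b. b \<in> Basis \<Longrightarrow> integrable lborel (f b)"
  shows "(\<integral>x. (\<Prod>b\<in>Basis. f b (x \<bullet> b)) \<partial>lborel) = (\<Prod>b\<in>Basis. \<integral>t. f b t \<partial>lborel)"
proof -
  interpret product_sigma_finite "\<lambda>b::'a. lborel :: real measure" ..
  have [measurable]: "f b \<in> borel_measurable borel" if "b \<in> Basis" for b
    using f[OF that] by simp
  have "(\<integral>x. (\<Prod>b\<in>Basis. f b (x \<bullet> b)) \<partial>lborel)
      = (\<integral>x. (\<Prod>b\<in>Basis. f b (x \<bullet> b)) \<partial>distr (\<Pi>\<^sub>M b\<in>Basis. lborel) borel (\<lambda>x. \<Sum>b\<in>Basis. x b *\<^sub>R b))"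
    by (simp flip: lborel_eq)
  also have "\<dots> = (\<integral>x. (\<Prod>b\<in>Basis. f b (x b)) \<partial>(\<Pi>\<^sub>M b\<in>Basis. lborel))"
    by (subst integral_distr) (auto intro!: Bochner_Integration.integral_cong prod.cong simp: inner_sum_left inner_Basis if_distrib cong: if_cong)
  also have "\<dots> = (\<Prod>b\<in>Basis. \<integral>t. f b t \<partial>lborel)"
    by (rule product_integral_prod) (auto intro: f)
  finally show ?thesis .
qed

text \<open>
  The coordinates are independent, so this is a product of one-dimensional characteristic
  functions.
\<close>
lemma char_std_gaussian:
  fixes c :: "'a::euclidean_space"
  shows "(\<integral>x. iexp (c \<bullet> x) \<partial>std_gaussian) = of_real (exp (- (norm c)\<^sup>2 / 2))"
proof -
  have char1: "(\<integral>t. std_normal_density t *\<^sub>R iexp (s * t) \<partial>lborel) = of_real (exp (- s\<^sup>2 / 2))"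
    and int1: "integrable lborel (\<lambda>t. std_normal_density t *\<^sub>R iexp (s * t))" for s :: real
  proof -
    interpret real_distribution std_normal_distribution by (rule real_dist_normal_dist)
    have "integrable std_normal_distribution (\<lambda>t. iexp (s * t))"
      by (intro integrable_iexp) auto
    then show "integrable lborel (\<lambda>t. std_normal_density t *\<^sub>R iexp (s * t))"
      by (subst (asm) integrable_density) (auto simp: normal_density_nonneg)
    have "(\<integral>t. std_normal_density t *\<^sub>R iexp (s * t) \<partial>lborel) = char std_normal_distribution s"
      unfolding char_def by (subst integral_density) (auto simp: normal_density_nonneg)
    then show "(\<integral>t. std_normal_density t *\<^sub>R iexp (s * t) \<partial>lborel) = of_real (exp (- s\<^sup>2 / 2))"
      by (simp add: char_std_normal_distribution)
  qed
  have "(\<integral>x. iexp (c \<bullet> x) \<partial>std_gaussian)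
      = (\<integral>x. (\<Prod>b\<in>Basis. std_normal_density (x \<bullet> b)) *\<^sub>R iexp (c \<bullet> x) \<partial>lborel)"
    unfolding std_gaussian_def gaussian_density_prod
    by (subst integral_density) (auto intro!: prod_nonneg simp: normal_density_nonneg)
  also have "\<dots> = (\<integral>x. (\<Prod>b\<in>Basis. std_normal_density (x \<bullet> b) *\<^sub>R iexp ((c \<bullet> b) * (x \<bullet> b))) \<partial>lborel)"
  proof (intro Bochner_Integration.integral_cong refl)
    fix x
    have "iexp (c \<bullet> x) = (\<Prod>b\<in>Basis. iexp ((c \<bullet> b) * (x \<bullet> b)))"
      by (subst euclidean_inner) (simp add: exp_sum[symmetric] sum_distrib_left)
    then show "(\<Prod>b\<in>Basis. std_normal_density (x \<bullet> b)) *\<^sub>R iexp (c \<bullet> x)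
        = (\<Prod>b\<in>Basis. std_normal_density (x \<bullet> b) *\<^sub>R iexp ((c \<bullet> b) * (x \<bullet> b)))"
      by (simp add: scaleR_conv_of_real prod.distrib)
  qed
  also have "\<dots> = (\<Prod>b\<in>Basis. of_real (exp (- (c \<bullet> b)\<^sup>2 / 2)))"
    by (subst integral_lborel_prod) (simp_all only: char1 int1)
  also have "\<dots> = of_real (exp (- (norm c)\<^sup>2 / 2))"
    by (simp add: norm_square_Basis exp_sum[symmetric] of_real_prod[symmetric] sum_negf sum_divide_distrib
        del: of_real_prod)
  finally show ?thesis .
qed

lemma AE_lborel_inner_neq:
  fixes a :: "'a::euclidean_space"
  assumes "a \<noteq> 0"
  shows "AE y in lborel. a \<bullet> y \<noteq> 0"
proof -
  have "{y. a \<bullet> y = 0} \<in> null_sets lborel"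
    using negligible_hyperplane[of a 0] assms
    by (auto simp: negligible_iff_null_sets null_sets_completion_iff)
  then show ?thesis
    by (rule AE_I') auto
qed

lemma AE_std_gaussian_inner_neq:
  fixes a :: "'a::euclidean_space"
  assumes "a \<noteq> 0"
  shows "AE y in std_gaussian. a \<bullet> y \<noteq> 0"
  unfolding std_gaussian_def using AE_lborel_inner_neq[OF assms] by (subst AE_density) auto

section \<open>A Cauchy law from a rotation of Gaussian pairs\<close>

text \<open>
  This is the gradient of \<open>y \<mapsto> \<Sum>j\<in>J. w j * ln \<bar>a j \<bullet> y\<bar>\<close>, and \<open>g_field\<close> is the case of an index set that
  carries the positive weights.
\<close>
definition log_gradient :: "'i set \<Rightarrow> ('i \<Rightarrow> 'a::euclidean_space) \<Rightarrow> ('i \<Rightarrow> real) \<Rightarrow> 'a \<Rightarrow> 'a" where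
  "log_gradient J a w y = (\<Sum>j\<in>J. w j *\<^sub>R (a j /\<^sub>R (a j \<bullet> y)))"

lemma measurable_log_gradient [measurable]: "log_gradient J a w \<in> borel_measurable borel"
  unfolding log_gradient_def[abs_def] by measurable

lemma inner_log_gradient: "log_gradient J a w y \<bullet> x = (\<Sum>j\<in>J. w j * ((a j \<bullet> x) / (a j \<bullet> y)))"
  by (simp add: log_gradient_def inner_sum_left field_simps)

text \<open>
  With the coordinates of the two vectors paired as complex numbers \<open>snd z \<bullet> b + \<i> * (fst z \<bullet> b)\<close>, this is
  multiplication by \<open>cis \<theta>\<close>.
\<close>
definition pair_rotation :: "real \<Rightarrow> 'a \<times> 'a \<Rightarrow> 'a \<times> 'a::euclidean_space" where
  "pair_rotation \<theta> z =
     (cos \<theta> *\<^sub>R fst z + sin \<theta> *\<^sub>R snd z, cos \<theta> *\<^sub>R snd z - sin \<theta> *\<^sub>R fst z)"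

lemma orthogonal_pair_rotation: "orthogonal_transformation (pair_rotation \<theta>)"
proof -
  have lin: "linear (pair_rotation \<theta> :: 'a \<times> 'a \<Rightarrow> 'a \<times> 'a)"
    by (rule linearI) (auto simp: pair_rotation_def algebra_simps)
  have "norm (pair_rotation \<theta> z) = norm z" for z :: "'a \<times> 'a"
  proof -
    have "pair_rotation \<theta> z \<bullet> pair_rotation \<theta> z
        = ((cos \<theta>)\<^sup>2 + (sin \<theta>)\<^sup>2) * (fst z \<bullet> fst z + snd z \<bullet> snd z)"
      by (simp add: pair_rotation_def inner_prod_def inner_simps inner_commute power2_eq_square algebra_simps
          del: sin_cos_squared_add sin_cos_squared_add2 sin_cos_squared_add3)
    then show ?thesis
      by (simp add: norm_eq_sqrt_inner inner_prod_def)
  qed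
  then show ?thesis
    using lin by (simp add: orthogonal_transformation)
qed

text \<open>
  For \<open>Re z = 0\<close> both sides vanish, by the convention for division by zero.  Hence the identification of
  Cayley transforms with tangents below holds at every angle, not just almost every one.
\<close>
lemma Cayley_unit_phase:
  fixes z :: complex
  assumes "z \<noteq> 0"
  shows "(1 - z / cnj z) / (1 + z / cnj z) = - (\<i> * of_real (Im z / Re z))"
proof -
  have "(1 - z / cnj z) / (1 + z / cnj z) = (cnj z - z) / (cnj z + z)"
    using assms by (simp add: divide_simps)
  also have "cnj z - z = - (2 * \<i> * of_real (Im z))" 
    by (simp add: complex_eq_iff)
  also have "cnj z + z = 2 * of_real (Re z)"
    by (simp add: complex_eq_iff)
  finally show ?thesis by simp
qed

text \<open>
  Put \<open>\<zeta> j = (a j \<bullet> snd z) + \<i> * (a j \<bullet> fst z)\<close>.  A rotation by the angle \<open>pi * x\<close> multiplies every \<open>\<zeta> j\<close> by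
  \<open>cis (pi * x)\<close>, and the ratio \<open>(a j \<bullet> fst z) / (a j \<bullet> snd z)\<close> is the tangent of the argument of \<open>\<zeta> j\<close>.
  The double angle that enters the Cayley transform runs once through the circle as \<open>x\<close> runs through
  the unit interval.
\<close>
lemma average_pair_rotation:
  fixes a :: "'i \<Rightarrow> 'a::euclidean_space" and z :: "'a \<times> 'a"
  assumes J: "finite J" and w: "\<And>j. j \<in> J \<Longrightarrow> 0 \<le> w j" "sum w J = 1"
    and nz: "\<And>j. j \<in> J \<Longrightarrow> a j \<bullet> snd z \<noteq> 0" and s: "0 \<le> s"
  shows "(\<integral>x. iexp (s * (log_gradient J a w (snd (pair_rotation (pi * x) z)) \<bullet> fst (pair_rotation (pi * x) z)))
      \<partial>unit_interval) = exp (- of_real s)"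
proof -
  define \<zeta> where "\<zeta> j = Complex (a j \<bullet> snd z) (a j \<bullet> fst z)" for j
  have \<zeta>: "\<zeta> j \<noteq> 0" if "j \<in> J" for j
    using nz[OF that] by (auto simp: \<zeta>_def complex_eq_iff)
  define u where "u j = \<zeta> j / cnj (\<zeta> j)" for j
  have u: "norm (u j) = 1" if "j \<in> J" for j
    using \<zeta>[OF that] by (simp add: u_def norm_divide)
  have "iexp (s * (log_gradient J a w (snd (pair_rotation (pi * x) z)) \<bullet> fst (pair_rotation (pi * x) z)))
      = exp (- of_real s * (\<Sum>j\<in>J. of_real (w j) *
          ((1 - u j * cis (2 * pi * x)) / (1 + u j * cis (2 * pi * x)))))" for x
  proof -
    have "of_real (w j) * ((1 - u j * cis (2 * pi * x)) / (1 + u j * cis (2 * pi * x)))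
        = - (\<i> * of_real (w j * ((a j \<bullet> fst (pair_rotation (pi * x) z)) / (a j \<bullet> snd (pair_rotation (pi * x) z)))))"
      if "j \<in> J" for j
    proof -
      define v where "v = cis (pi * x) * \<zeta> j"
      have "cis (2 * pi * x) = cis (pi * x) / cnj (cis (pi * x))"
        by (simp add: cis_cnj cis_divide mult.assoc)
      then have uv: "u j * cis (2 * pi * x) = v / cnj v"
        by (simp add: u_def v_def mult_ac)
      have "v \<noteq> 0" using \<zeta>[OF that] by (simp add: v_def)
      moreover have "Im v = a j \<bullet> fst (pair_rotation (pi * x) z)" "Re v = a j \<bullet> snd (pair_rotation (pi * x) z)"
        by (simp_all add: v_def \<zeta>_def pair_rotation_def inner_simps)
      ultimately show ?thesis
        unfolding uv by (subst Cayley_unit_phase) simp_all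
    qed
    then have "(\<Sum>j\<in>J. of_real (w j) * ((1 - u j * cis (2 * pi * x)) / (1 + u j * cis (2 * pi * x))))
        = (\<Sum>j\<in>J. - (\<i> * of_real (w j * ((a j \<bullet> fst (pair_rotation (pi * x) z)) / (a j \<bullet> snd (pair_rotation (pi * x) z))))))"
      by (rule sum.cong[OF refl])
    also have "\<dots> = - (\<i> * of_real (log_gradient J a w (snd (pair_rotation (pi * x) z)) \<bullet> fst (pair_rotation (pi * x) z)))"
      unfolding inner_log_gradient sum_negf of_real_sum sum_distrib_left ..
    finally show ?thesis by (simp add: mult_ac)
  qed
  then show ?thesis
    using integral_Cayley_phases[of J w u s] J w u s by simp
qed

lemma integral_pair_rotation:
  fixes f :: "'a::euclidean_space \<times> 'a \<Rightarrow> complex"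
  assumes f: "f \<in> borel_measurable borel"
  shows "(\<integral>z. f (pair_rotation \<theta> z) \<partial>std_gaussian) = (\<integral>z. f z \<partial>std_gaussian)"
proof -
  have [measurable]: "(pair_rotation \<theta> :: 'a \<times> 'a \<Rightarrow> _) \<in> borel_measurable borel"
    unfolding pair_rotation_def[abs_def]
    by (intro borel_measurable_continuous_onI continuous_intros)
  have "(\<integral>z. f z \<partial>std_gaussian) = (\<integral>z. f z \<partial>distr std_gaussian borel (pair_rotation \<theta>))"
    by (simp add: distr_std_gaussian_orthogonal orthogonal_pair_rotation)
  also have "\<dots> = (\<integral>z. f (pair_rotation \<theta> z) \<partial>std_gaussian)"
    by (rule integral_distr) (use f in auto)
  finally show ?thesis ..
qed

text \<open>
  The expectation does not change when the pair is rotated, hence it equals its average over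
  all rotations.  By Fubini that average can be taken first, for each fixed pair, where it is the
  constant \<open>exp (- s)\<close>.
\<close>
lemma char_log_gradient_Cauchy:
  fixes a :: "'i \<Rightarrow> 'a::euclidean_space"
  assumes J: "finite J" and w: "\<And>j. j \<in> J \<Longrightarrow> 0 \<le> w j" "sum w J = 1"
    and a: "\<And>j. j \<in> J \<Longrightarrow> a j \<noteq> 0" and s: "0 \<le> s"
  shows "(\<integral>z. iexp (s * (log_gradient J a w (snd z) \<bullet> fst z)) \<partial>std_gaussian) = exp (- of_real s)"
proof -
  interpret G: prob_space "std_gaussian :: ('a \<times> 'a) measure" by (rule prob_space_std_gaussian)
  interpret U: prob_space unit_interval by (rule prob_space_unit_interval)
  interpret pair_sigma_finite unit_interval "std_gaussian :: ('a \<times> 'a) measure" ..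
  interpret GU: pair_prob_space unit_interval "std_gaussian :: ('a \<times> 'a) measure" ..
  have [measurable]: "(fst :: 'a \<times> 'a \<Rightarrow> 'a) \<in> borel_measurable borel" "(snd :: 'a \<times> 'a \<Rightarrow> 'a) \<in> borel_measurable borel"
    by (auto intro!: borel_measurable_continuous_onI continuous_intros)
  define f where "f z = iexp (s * (log_gradient J a w (snd z) \<bullet> fst z))" for z :: "'a \<times> 'a"
  have f [measurable]: "f \<in> borel_measurable borel"
    unfolding f_def by measurable
  have rot [measurable]: "(\<lambda>(x, z). pair_rotation (pi * x) z) \<in> unit_interval \<Otimes>\<^sub>M (std_gaussian :: ('a \<times> 'a) measure) \<rightarrow>\<^sub>M borel"
    unfolding pair_rotation_def by measurable
  have int: "integrable (unit_interval \<Otimes>\<^sub>M std_gaussian) (\<lambda>(x, z). f (pair_rotation (pi * x) z))"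
  proof (rule GU.integrable_const_bound[where B = 1])
    show "(\<lambda>(x, z). f (pair_rotation (pi * x) z)) \<in> borel_measurable (unit_interval \<Otimes>\<^sub>M std_gaussian)"
      using measurable_compose[OF rot f] by (simp add: case_prod_beta')
  qed (auto simp: f_def)
  have "(\<integral>z. f z \<partial>std_gaussian) = (\<integral>x. (\<integral>z. f (pair_rotation (pi * x) z) \<partial>std_gaussian) \<partial>unit_interval)"
    by (simp add: integral_pair_rotation[OF f] U.prob_space)
  also have "\<dots> = (\<integral>z. (\<integral>x. f (pair_rotation (pi * x) z) \<partial>unit_interval) \<partial>std_gaussian)"
    by (rule Fubini_integral[OF int, symmetric])
  also have "\<dots> = (\<integral>z. exp (- of_real s) \<partial>(std_gaussian :: ('a \<times> 'a) measure))"
  proof (rule integral_cong_AE)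
    show "(\<lambda>z. \<integral>x. f (pair_rotation (pi * x) z) \<partial>unit_interval) \<in> borel_measurable std_gaussian"
      using int by (intro U.borel_measurable_lebesgue_integral) (auto simp: case_prod_beta' measurable_split_conv)
    \<comment> \<open>the condition on the second vector is a hyperplane condition in the product space\<close>
    have "AE z in std_gaussian. \<forall>j\<in>J. (0, a j) \<bullet> z \<noteq> 0"
      using J a by (intro AE_finite_allI AE_std_gaussian_inner_neq) (auto simp: zero_prod_def)
    then show "AE z in std_gaussian. (\<integral>x. f (pair_rotation (pi * x) z) \<partial>unit_interval) = exp (- of_real s)"
      unfolding f_def by eventually_elim (rule average_pair_rotation, use J w s in \<open>auto simp: inner_prod_def\<close>)
  qed simp
  also have "\<dots> = exp (- of_real s)"
    using G.prob_space by simp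
  finally show ?thesis by (simp add: f_def)
qed

text \<open>
  For fixed \<open>y\<close> the integral over the first vector in the preceding lemma is the Gaussian
  characteristic function at \<open>s *\<^sub>R log_gradient J a w y\<close>.
\<close>
lemma nn_integral_exp_log_gradient:
  fixes a :: "'i \<Rightarrow> 'a::euclidean_space"
  assumes "finite J" "\<And>j. j \<in> J \<Longrightarrow> 0 \<le> w j" "sum w J = 1" "\<And>j. j \<in> J \<Longrightarrow> a j \<noteq> 0" "0 \<le> s"
  shows "(\<integral>\<^sup>+y. exp (- (s * norm (log_gradient J a w y))\<^sup>2 / 2) \<partial>std_gaussian) = exp (- s)"
proof -
  interpret G: prob_space "std_gaussian :: 'a measure" by (rule prob_space_std_gaussian)
  interpret pair_prob_space "std_gaussian :: 'a measure" "std_gaussian :: 'a measure" ..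
  define h where "h y = exp (- (s * norm (log_gradient J a w y))\<^sup>2 / 2)" for y
  have "integrable (std_gaussian \<Otimes>\<^sub>M std_gaussian) (\<lambda>(x, y). iexp (s * (log_gradient J a w y \<bullet> x)))"
    by (rule integrable_const_bound[where B = 1]) auto
  then have "(\<integral>z. iexp (s * (log_gradient J a w (snd z) \<bullet> fst z)) \<partial>(std_gaussian \<Otimes>\<^sub>M std_gaussian))
      = (\<integral>y. (\<integral>x. iexp (s * (log_gradient J a w y \<bullet> x)) \<partial>std_gaussian) \<partial>std_gaussian)"
    by (subst integral_snd) (auto simp: case_prod_beta')
  also have "\<dots> = (\<integral>y. of_real (h y) \<partial>std_gaussian)"
  proof (rule Bochner_Integration.integral_cong[OF refl])
    fix y
    show "(\<integral>x. iexp (s * (log_gradient J a w y \<bullet> x)) \<partial>std_gaussian) = of_real (h y)"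
      using char_std_gaussian[of "s *\<^sub>R log_gradient J a w y"] assms(5) by (simp add: h_def)
  qed
  also have "\<dots> = of_real (\<integral>y. h y \<partial>std_gaussian)"
    by simp
  finally have "of_real (\<integral>y. h y \<partial>std_gaussian) = complex_of_real (exp (- s))"
    using char_log_gradient_Cauchy[of J w a s] assms by (simp add: std_gaussian_pair exp_of_real[symmetric])
  then have eq: "(\<integral>y. h y \<partial>std_gaussian) = exp (- s)"
    by (simp only: of_real_eq_iff)
  have "(\<integral>\<^sup>+y. h y \<partial>std_gaussian) = ennreal (\<integral>y. h y \<partial>std_gaussian)"
    by (intro nn_integral_eq_integral G.integrable_const_bound[where B = 1]) (auto simp: h_def)
  then show ?thesis
    by (simp only: eq) (simp only: h_def)
qed

section \<open>Gaussian moments\<close>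

lemma Gamma_half_integer: "Gamma (real k + 1/2) = fact (2 * k) / (4 ^ k * fact k) * sqrt pi"
proof (induction k)
  case 0
  show ?case by (simp add: Gamma_one_half_real)
next
  case (Suc k)
  have "Gamma (real (Suc k) + 1/2) = Gamma ((real k + 1/2) + 1)"
    by (simp add: add_ac)
  also have "\<dots> = (real k + 1/2) * Gamma (real k + 1/2)"
    by (rule Gamma_plus1) (auto elim!: nonpos_Ints_cases simp: add_eq_0_iff)
  also have "\<dots> = fact (2 * Suc k) / (4 ^ Suc k * fact (Suc k)) * sqrt pi"
    unfolding Suc.IH by (simp add: divide_simps) (simp add: algebra_simps)
  finally show ?case .
qed

text \<open>
  One formula for both parities of \<open>q\<close>, so that it can serve the odd exponents of the Laplace variable
  and the radial exponents in any dimension alike.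
\<close>
lemma nn_integral_power_exp_square_unit:
  "(\<integral>\<^sup>+t. ennreal (t ^ q * exp (- t\<^sup>2)) * indicator {0..} t \<partial>lborel) = ennreal (Gamma ((real q + 1) / 2) / 2)"
proof -
  have "has_bochner_integral lborel (\<lambda>t. indicator {0..} t *\<^sub>R (exp (- t\<^sup>2) * t ^ q)) (Gamma ((real q + 1) / 2) / 2)"
  proof (cases "even q")
    case True
    then obtain k where q: "q = 2 * k" by (elim evenE)
    have "(2::real) ^ (2 * k) = 4 ^ k" by (simp add: power_mult)
    then have G: "Gamma ((real q + 1) / 2) / 2 = sqrt pi / 2 * (fact (2 * k) / (2 ^ (2 * k) * fact k))"
      using Gamma_half_integer[of k] by (simp add: q add_divide_distrib mult.commute mult.left_commute)
    then show ?thesis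
      using gaussian_moment_even_pos[of k] unfolding G by (simp only: q)
  next
    case False
    then obtain k where q: "q = 2 * k + 1" by (elim oddE)
    have "Gamma ((real q + 1) / 2) / 2 = fact k / 2"
      using Gamma_fact[of k, where 'a = real] by (simp add: q add_divide_distrib add_ac)
    then show ?thesis
      using gaussian_moment_odd_pos[of k] by (simp add: q)
  qed
  then have "(\<integral>\<^sup>+t. ennreal (indicator {0..} t *\<^sub>R (exp (- t\<^sup>2) * t ^ q)) \<partial>lborel) = ennreal (Gamma ((real q + 1) / 2) / 2)"
    by (subst nn_integral_eq_integral) (auto simp: has_bochner_integral_iff indicator_def)
  also have "(\<integral>\<^sup>+t. ennreal (indicator {0..} t *\<^sub>R (exp (- t\<^sup>2) * t ^ q)) \<partial>lborel)
      = (\<integral>\<^sup>+t. ennreal (t ^ q * exp (- t\<^sup>2)) * indicator {0..} t \<partial>lborel)"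
    by (intro nn_integral_cong) (auto simp: indicator_def mult.commute)
  finally show ?thesis .
qed

lemma nn_integral_power_exp_square:
  assumes c: "0 < c"
  shows "(\<integral>\<^sup>+t. ennreal (t ^ q * exp (- (c * t)\<^sup>2)) * indicator {0..} t \<partial>lborel)
    = ennreal (Gamma ((real q + 1) / 2) / (2 * c ^ Suc q))"
proof -
  define I where "I = (\<integral>\<^sup>+t. ennreal (t ^ q * exp (- (c * t)\<^sup>2)) * indicator {0..} t \<partial>lborel)"
  have "ennreal (Gamma ((real q + 1) / 2) / 2)
      = c * (\<integral>\<^sup>+t. ennreal ((c * t) ^ q * exp (- (c * t)\<^sup>2)) * indicator {0..} (c * t) \<partial>lborel)"
    using c by (subst nn_integral_power_exp_square_unit[symmetric], subst nn_integral_real_affine[where c = c and t = 0])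
      auto
  also have "\<dots> = c * (\<integral>\<^sup>+t. ennreal (c ^ q) * (ennreal (t ^ q * exp (- (c * t)\<^sup>2)) * indicator {0..} t) \<partial>lborel)"
  proof -
    have "ennreal ((c * t) ^ q * exp (- (c * t)\<^sup>2)) * indicator {0..} (c * t)
        = ennreal (c ^ q) * (ennreal (t ^ q * exp (- (c * t)\<^sup>2)) * indicator {0..} t)" for t
      using c by (cases "0 \<le> t") (auto simp: indicator_def power_mult_distrib mult.assoc zero_le_mult_iff ennreal_mult)
    then show ?thesis by simp
  qed
  also have "\<dots> = ennreal (c ^ Suc q) * I"
    using c by (subst nn_integral_cmult) (auto simp: I_def ennreal_mult' mult_ac)
  finally have "ennreal (c ^ Suc q) * I = ennreal (Gamma ((real q + 1) / 2) / 2)" ..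
  then have "ennreal (inverse (c ^ Suc q)) * (ennreal (c ^ Suc q) * I)
      = ennreal (inverse (c ^ Suc q)) * ennreal (Gamma ((real q + 1) / 2) / 2)" by simp
  also have "ennreal (inverse (c ^ Suc q)) * (ennreal (c ^ Suc q) * I) = I"
    using c by (simp add: mult.assoc[symmetric] ennreal_mult'[symmetric] del: power_Suc)
  also have "ennreal (inverse (c ^ Suc q)) * ennreal (Gamma ((real q + 1) / 2) / 2)
      = ennreal (Gamma ((real q + 1) / 2) / (2 * c ^ Suc q))"
    using c by (subst ennreal_mult'[symmetric]) (auto simp: field_simps)
  finally show ?thesis by (simp add: I_def)
qed

text \<open>
  Euler's identity for the weighted geometric mean of the \<open>\<bar>a j \<bullet> y\<bar>\<close>, which is homogeneous of degree one
  and whose logarithm has the gradient \<open>log_gradient J a w\<close>.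
\<close>
lemma inner_self_log_gradient:
  assumes "sum w J = 1" "\<And>j. j \<in> J \<Longrightarrow> a j \<bullet> y \<noteq> 0"
  shows "y \<bullet> log_gradient J a w y = 1"
  using assms by (simp add: inner_log_gradient inner_commute[of y])

text \<open>
  For \<open>c > 0\<close> the integral of \<open>s ^ (2 * n - 1) * exp (- (s * c)\<^sup>2 / 2)\<close> over the positive half line is a
  constant times \<open>(1 / c\<^sup>2) ^ n\<close>.  With \<open>c = norm (log_gradient J a w y)\<close> and the order of integration
  exchanged, the known Laplace transform leaves the integral of \<open>s ^ (2 * n - 1) * exp (- s)\<close>.  The
  duplication formula at half-integers gives the final form.  These are the moments of the square of a
  standard normal variable.
\<close>
lemma gaussian_moment_inverse_norm_log_gradient:
  fixes a :: "'i \<Rightarrow> 'a::euclidean_space"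
  assumes J: "finite J" and w: "\<And>j. j \<in> J \<Longrightarrow> 0 \<le> w j" "sum w J = 1"
    and a: "\<And>j. j \<in> J \<Longrightarrow> a j \<noteq> 0"
  shows "(\<integral>\<^sup>+y. ennreal ((1 / (norm (log_gradient J a w y))\<^sup>2) ^ n) \<partial>std_gaussian)
    = ennreal (2 ^ n * Gamma (real n + 1/2) / Gamma (1/2))"
proof (cases n)
  case 0
  show ?thesis
    using prob_space.emeasure_space_1[OF prob_space_std_gaussian] Gamma_real_pos[of "1/2"]
    by (simp add: 0 Gamma_one_half_real)
next
  case (Suc m)
  interpret G: prob_space "std_gaussian :: 'a measure" by (rule prob_space_std_gaussian)
  interpret pair_sigma_finite "std_gaussian :: 'a measure" "lborel :: real measure" ..
  define g where "g = log_gradient J a w"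
  have [measurable]: "g \<in> borel_measurable borel" by (simp add: g_def)
  \<comment> \<open>this is \<open>2 * n - 1\<close>, and \<open>C\<close> is the constant that this power produces\<close>
  define q where "q = 2 * m + 1"
  define C where "C = Gamma (real n) * 2 ^ m"
  have n: "Gamma (real n) = fact m" by (simp add: Suc Gamma_fact)
  have "AE y in std_gaussian. \<forall>j\<in>J. a j \<bullet> y \<noteq> 0"
    using J a by (intro AE_finite_allI AE_std_gaussian_inner_neq) auto
  then have "AE y in std_gaussian. g y \<noteq> 0"
    by eventually_elim (use inner_self_log_gradient[OF w(2)] in \<open>force simp: g_def\<close>)
  then have "(\<integral>\<^sup>+y. ennreal C * ennreal ((1 / (norm (g y))\<^sup>2) ^ n) \<partial>std_gaussian)
      = (\<integral>\<^sup>+y. (\<integral>\<^sup>+s. ennreal (s ^ q * exp (- (s * norm (g y))\<^sup>2 / 2)) * indicator {0..} s \<partial>lborel) \<partial>std_gaussian)"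
  proof (intro nn_integral_cong_AE, eventually_elim)
    case (elim y)
    have "(\<integral>\<^sup>+s. ennreal (s ^ q * exp (- (s * norm (g y))\<^sup>2 / 2)) * indicator {0..} s \<partial>lborel)
        = (\<integral>\<^sup>+s. ennreal (s ^ q * exp (- (norm (g y) / sqrt 2 * s)\<^sup>2)) * indicator {0..} s \<partial>lborel)"
      by (simp add: power_mult_distrib power_divide mult_ac)
    also have "\<dots> = ennreal (Gamma ((real q + 1) / 2) / (2 * (norm (g y) / sqrt 2) ^ Suc q))"
      using elim by (intro nn_integral_power_exp_square) auto
    also have "Suc q = 2 * n" by (simp add: q_def Suc)
    also have "(real q + 1) / 2 = real n" by (simp add: q_def Suc)
    also have "Gamma (real n) / (2 * (norm (g y) / sqrt 2) ^ (2 * n)) = C * (1 / (norm (g y))\<^sup>2) ^ n"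
    proof -
      have "(2::real) ^ n = 2 * 2 ^ m" by (simp add: Suc)
      then show ?thesis
        by (simp add: C_def power_mult power_divide del: power_Suc)
    qed
    finally show ?case
      by (simp add: ennreal_mult' C_def n)
  qed
  also have "\<dots> = (\<integral>\<^sup>+s. (\<integral>\<^sup>+y. ennreal (s ^ q * exp (- (s * norm (g y))\<^sup>2 / 2)) * indicator {0..} s \<partial>std_gaussian) \<partial>lborel)"
    by (rule Fubini'[symmetric]) measurable
  also have "\<dots> = (\<integral>\<^sup>+s. ennreal (s ^ q * exp (- s)) * indicator {0..} s \<partial>lborel)"
  proof (intro nn_integral_cong)
    fix s :: real
    show "(\<integral>\<^sup>+y. ennreal (s ^ q * exp (- (s * norm (g y))\<^sup>2 / 2)) * indicator {0..} s \<partial>std_gaussian)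
        = ennreal (s ^ q * exp (- s)) * indicator {0..} s"
    proof (cases "0 \<le> s")
      case True
      then have "(\<integral>\<^sup>+y. ennreal (s ^ q * exp (- (s * norm (g y))\<^sup>2 / 2)) * indicator {0..} s \<partial>std_gaussian)
        = (\<integral>\<^sup>+y. ennreal (s ^ q) * ennreal (exp (- (s * norm (g y))\<^sup>2 / 2)) \<partial>std_gaussian)"
        by (simp add: ennreal_mult')
      also have "\<dots> = ennreal (s ^ q) * ennreal (exp (- s))"
        unfolding g_def by (subst nn_integral_cmult) (use nn_integral_exp_log_gradient[OF J w a True] in simp_all)
      finally show ?thesis using True by (simp add: ennreal_mult')
    qed auto
  qed
  also have "\<dots> = ennreal (fact q)"
    by (simp add: nn_intergal_power_times_exp_Ici)
  finally have eq: "ennreal C * (\<integral>\<^sup>+y. ennreal ((1 / (norm (g y))\<^sup>2) ^ n) \<partial>std_gaussian) = ennreal (fact q)"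
    by (subst (asm) nn_integral_cmult) auto
  have C: "C > 0" by (simp add: C_def n)
  have "(\<integral>\<^sup>+y. ennreal ((1 / (norm (g y))\<^sup>2) ^ n) \<partial>std_gaussian)
      = ennreal (1 / C) * (ennreal C * (\<integral>\<^sup>+y. ennreal ((1 / (norm (g y))\<^sup>2) ^ n) \<partial>std_gaussian))"
    using C by (simp add: mult.assoc[symmetric] ennreal_mult'[symmetric])
  also have "\<dots> = ennreal (fact q / C)"
    unfolding eq using C by (subst ennreal_mult'[symmetric]) auto
  also have "fact q / C = 2 ^ n * Gamma (real n + 1/2) / Gamma (1/2)"
  proof -
    have "fact (2 * n) = real (2 * n) * fact q"
      by (simp add: q_def Suc)
    moreover have "(4::real) ^ n = 2 ^ n * (2 * 2 ^ m)"
      by (simp add: Suc flip: power_mult_distrib)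
    moreover have "fact n = real n * fact m"
      by (simp add: Suc)
    ultimately have "Gamma (real n + 1/2) = 2 * real n * fact q / (2 ^ n * (2 * 2 ^ m) * (real n * fact m)) * sqrt pi"
      by (simp add: Gamma_half_integer[of n] del: power_Suc)
    then show ?thesis
      unfolding Gamma_one_half_real C_def n using Suc by (simp del: power_Suc of_nat_Suc)
  qed
  finally show ?thesis by (simp add: g_def)
qed

section \<open>From the Gaussian measure to the sphere\<close>

lemma measurable_sgn [measurable]: "(sgn :: 'a::euclidean_space \<Rightarrow> 'a) \<in> borel_measurable borel"
  by (simp add: sgn_div_norm)

lemma sets_sphere_uniform [measurable_cong, simp]: "sets sphere_uniform = sets borel"
  and space_sphere_uniform [simp]: "space sphere_uniform = UNIV"
  by (simp_all add: sphere_uniform_def)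

text \<open>
  This is the definition of the uniform law by cones over the unit ball, read as a statement about
  integrals.
\<close>
lemma nn_integral_sphere_uniform:
  fixes f :: "'a::euclidean_space \<Rightarrow> ennreal"
  assumes [measurable]: "f \<in> borel_measurable borel"
  shows "(\<integral>\<^sup>+x. f (sgn x) * indicator (ball 0 1) x \<partial>lborel)
    = measure lborel (ball 0 1 :: 'a set) * (\<integral>\<^sup>+u. f u \<partial>sphere_uniform)"
proof -
  have fin: "emeasure lborel (ball 0 1 :: 'a set) \<noteq> \<infinity>"
    using emeasure_lborel_ball_finite[of "0::'a" 1] by simp
  have v: "emeasure lborel (ball 0 1 :: 'a set) = ennreal (measure lborel (ball 0 1 :: 'a set))"
    using fin by (simp add: emeasure_eq_ennreal_measure)
  have "(\<integral>\<^sup>+u. f u \<partial>sphere_uniform)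
      = (\<integral>\<^sup>+x. f (sgn x) * indicator (ball 0 1) x \<partial>lborel) / measure lborel (ball 0 1 :: 'a set)"
    unfolding sphere_uniform_def by (simp add: nn_integral_distr nn_integral_uniform_measure v)
  moreover have "measure lborel (ball 0 1 :: 'a set) > 0"
    using content_ball_pos[of 1 "0::'a"] by simp
  then have "ennreal (measure lborel (ball 0 1 :: 'a set)) * X / measure lborel (ball 0 1 :: 'a set) = X" for X
    using mult_divide_eq_ennreal[of "measure lborel (ball 0 1 :: 'a set)" X] by (simp add: mult.commute)
  ultimately show ?thesis
    by (simp add: ennreal_times_divide)
qed

lemma nn_integral_lborel_scaleR:
  fixes f :: "'a::euclidean_space \<Rightarrow> ennreal"
  assumes [measurable]: "f \<in> borel_measurable borel" and r: "0 < r"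
  shows "(\<integral>\<^sup>+x. f x \<partial>lborel) = ennreal (r ^ DIM('a)) * (\<integral>\<^sup>+x. f (r *\<^sub>R x) \<partial>lborel)"
  using r by (subst lborel_affine[of r 0]) (simp_all add: nn_integral_density nn_integral_distr nn_integral_cmult)

text \<open>
  For a fixed \<open>f\<close>, both sides are integrals of \<open>F\<close> against measures on the line, so it suffices to compare
  these on the intervals \<open>{..<r}\<close>.  There scaling by \<open>r\<close> reduces the left side to the unit ball, and the right
  side is an elementary integral.  The finiteness of the integral of \<open>f\<close> is what makes the intervals an exhaustion
  by sets of finite measure.
\<close>
lemma nn_integral_polar:
  fixes f :: "'a::euclidean_space \<Rightarrow> ennreal" and F :: "real \<Rightarrow> ennreal"
  assumes f [measurable]: "f \<in> borel_measurable borel" and F [measurable]: "F \<in> borel_measurable borel"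
    and fin: "(\<integral>\<^sup>+u. f u \<partial>sphere_uniform) < \<infinity>"
  shows "(\<integral>\<^sup>+x. F (norm x) * f (sgn x) \<partial>lborel) = (\<integral>\<^sup>+u. f u \<partial>sphere_uniform) *
    (\<integral>\<^sup>+r. F r * ennreal (real DIM('a) * measure lborel (ball 0 1 :: 'a set) * r ^ (DIM('a) - 1)) * indicator {0..} r \<partial>lborel)"
proof -
  define I where "I = (\<integral>\<^sup>+u. f u \<partial>sphere_uniform)"
  define v where "v = measure lborel (ball 0 1 :: 'a set)"
  define \<delta> where "\<delta> r = ennreal (real DIM('a) * v * r ^ (DIM('a) - 1)) * indicator {0..} r" for r :: real
  have \<delta> [measurable]: "\<delta> \<in> borel_measurable borel" unfolding \<delta>_def by measurable
  have v: "v \<ge> 0" by (simp add: v_def)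
  define \<mu> where "\<mu> = distr (density lborel (\<lambda>x. f (sgn x))) borel norm"
  define \<nu> where "\<nu> = density lborel (\<lambda>r. I * \<delta> r)"
  have \<mu>_eq: "emeasure \<mu> {..<r} = I * ennreal (v * r ^ DIM('a))" if "r > 0" for r
  proof -
    have [measurable]: "ball 0 r \<in> sets (borel :: 'a measure)" by simp
    have "norm -` {..<r} = (ball 0 r :: 'a set)" by auto
    then have "emeasure \<mu> {..<r} = (\<integral>\<^sup>+x. f (sgn x) * indicator (ball 0 r) x \<partial>lborel)"
      unfolding \<mu>_def by (simp add: emeasure_distr emeasure_density)
    also have "\<dots> = ennreal (r ^ DIM('a)) * (\<integral>\<^sup>+x. f (sgn (r *\<^sub>R x)) * indicator (ball 0 r) (r *\<^sub>R x) \<partial>(lborel :: 'a measure))"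
      by (rule nn_integral_lborel_scaleR[OF _ that]) measurable
    also have "(\<integral>\<^sup>+x. f (sgn (r *\<^sub>R x)) * indicator (ball 0 r) (r *\<^sub>R x) \<partial>(lborel :: 'a measure))
        = (\<integral>\<^sup>+x. f (sgn x) * indicator (ball 0 1) x \<partial>lborel)"
      using that by (intro nn_integral_cong) (auto simp: indicator_def sgn_scaleR)
    also have "\<dots> = v * I"
      unfolding v_def I_def by (rule nn_integral_sphere_uniform) fact
    finally show ?thesis
      using v that by (simp add: ennreal_mult' mult_ac)
  qed
  have \<nu>_eq: "emeasure \<nu> {..<r} = I * ennreal (v * r ^ DIM('a))" if "r > 0" for r
  proof -
    have "emeasure \<nu> {..<r} = (\<integral>\<^sup>+t. I * (ennreal (real DIM('a) * v * t ^ (DIM('a) - 1)) * indicator {0..r} t) \<partial>lborel)"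
      unfolding \<nu>_def
    proof (subst emeasure_density)
      have "AE t in lborel. t \<noteq> r" by (rule AE_lborel_singleton)
      then show "(\<integral>\<^sup>+t. I * \<delta> t * indicator {..<r} t \<partial>lborel) =
          (\<integral>\<^sup>+t. I * (ennreal (real DIM('a) * v * t ^ (DIM('a) - 1)) * indicator {0..r} t) \<partial>lborel)"
        by (intro nn_integral_cong_AE, eventually_elim) (auto simp: \<delta>_def indicator_def)
    qed auto
    also have "\<dots> = I * (\<integral>\<^sup>+t. ennreal (real DIM('a) * v * t ^ (DIM('a) - 1)) * indicator {0..r} t \<partial>lborel)"
      by (rule nn_integral_cmult) measurable
    also have "(\<integral>\<^sup>+t. ennreal (real DIM('a) * v * t ^ (DIM('a) - 1)) * indicator {0..r} t \<partial>lborel)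
        = ennreal (v * r ^ DIM('a) - v * 0 ^ DIM('a))"
      using v that by (intro nn_integral_FTC_Icc) (auto intro!: derivative_eq_intros)
    finally show ?thesis using DIM_positive[where 'a = 'a] by (simp add: zero_power)
  qed
  have "\<mu> = \<nu>"
  proof (rule measure_eqI_generator_eq[where E = "range lessThan" and \<Omega> = UNIV and A = "\<lambda>n. {..<real (Suc n)}"])
    show "Int_stable (range lessThan :: real set set)"
    proof (rule Int_stableI)
      fix A B :: "real set" assume "A \<in> range lessThan" "B \<in> range lessThan"
      then obtain a b where "A = {..<a}" "B = {..<b}" by auto
      then have "A \<inter> B = {..<min a b}" by auto
      then show "A \<inter> B \<in> range lessThan" by blast
    qed
    have "sets (borel :: real measure) = sigma_sets UNIV (range lessThan)"
      using arg_cong[OF borel_eq_lessThan[where 'a = real], of sets] by (simp add: lessThan_def eucl_less_def)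
    then show "sets \<mu> = sigma_sets UNIV (range lessThan)" "sets \<nu> = sigma_sets UNIV (range lessThan)"
      by (simp_all add: \<mu>_def \<nu>_def)
    show "(\<Union>n. {..<real (Suc n)}) = UNIV"
    proof -
      have "\<exists>n. x < real (Suc n)" for x
        using reals_Archimedean2[of x] by (metis less_trans lessI of_nat_less_iff)
      then show ?thesis by auto
    qed
    show "emeasure \<mu> {..<real (Suc n)} \<noteq> \<infinity>" for n
      using fin by (subst \<mu>_eq) (auto simp: I_def ennreal_mult_eq_top_iff)
    fix X :: "real set" assume "X \<in> range lessThan"
    then obtain r where X: "X = {..<r}" by auto
    show "emeasure \<mu> X = emeasure \<nu> X"
    proof (cases "r > 0")
      case True
      then show ?thesis by (simp add: X \<mu>_eq \<nu>_eq)
    next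
      case False
      have "\<not> norm x < r" for x :: 'a using False norm_ge_zero[of x] by linarith
      then have "norm -` {..<r} = ({} :: 'a set)" by auto
      then have "emeasure \<mu> X = 0" by (simp add: X \<mu>_def emeasure_distr)
      moreover have "(\<lambda>t. I * \<delta> t * indicator {..<r} t) = (\<lambda>t. 0)"
        using False by (auto simp: \<delta>_def indicator_def)
      then have "emeasure \<nu> X = 0"
        unfolding \<nu>_def X by (subst emeasure_density) simp_all
      ultimately show ?thesis by simp
    qed
  qed auto
  then have "(\<integral>\<^sup>+r. F r \<partial>\<mu>) = (\<integral>\<^sup>+r. F r \<partial>\<nu>)" by simp
  also have "(\<integral>\<^sup>+r. F r \<partial>\<mu>) = (\<integral>\<^sup>+x. F (norm x) * f (sgn x) \<partial>lborel)"
    unfolding \<mu>_def by (simp add: nn_integral_distr nn_integral_density mult.commute)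
  also have "(\<integral>\<^sup>+r. F r \<partial>\<nu>) = I * (\<integral>\<^sup>+r. F r * \<delta> r \<partial>lborel)"
    unfolding \<nu>_def by (simp add: nn_integral_density nn_integral_cmult mult_ac)
  finally show ?thesis
    by (simp add: I_def \<delta>_def v_def mult.assoc)
qed

text \<open>
  In polar coordinates the radial and the angular part separate.  The volume of the ball enters the
  radial constant \<open>c\<close> below; instead of computing it, the proof compares with the total mass,
  that is with \<open>n = 0\<close> and \<open>f = 1\<close>.
\<close>
lemma gaussian_homogeneous_moment:
  fixes f :: "'a::euclidean_space \<Rightarrow> ennreal"
  assumes f [measurable]: "f \<in> borel_measurable borel" and fin: "(\<integral>\<^sup>+u. f u \<partial>sphere_uniform) < \<infinity>"
  shows "(\<integral>\<^sup>+y. ennreal (norm y ^ (2 * n)) * f (sgn y) \<partial>std_gaussian)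
    = (\<integral>\<^sup>+u. f u \<partial>sphere_uniform) *
      ennreal (2 ^ n * Gamma (real n + real DIM('a) / 2) / Gamma (real DIM('a) / 2))"
proof -
  let ?D = "DIM('a)"
  define v where "v = measure lborel (ball 0 1 :: 'a set)"
  define c where "c = real ?D * v / sqrt (2 * pi) ^ ?D * sqrt 2 ^ ?D / 2"
  have c: "c \<ge> 0" by (simp add: c_def v_def)
  have radial: "(\<integral>\<^sup>+y. ennreal (norm y ^ (2 * n)) * f (sgn y) \<partial>std_gaussian)
      = (\<integral>\<^sup>+u. f u \<partial>sphere_uniform) * ennreal (c * 2 ^ n * Gamma (real n + real ?D / 2))"
    if [measurable]: "f \<in> borel_measurable borel" and fin: "(\<integral>\<^sup>+u. f u \<partial>sphere_uniform) < \<infinity>" for f :: "'a \<Rightarrow> ennreal" and n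
  proof -
    define F where "F r = ennreal (r ^ (2 * n) * (exp (- r\<^sup>2 / 2) / sqrt (2 * pi) ^ ?D))" for r :: real
    have [measurable]: "F \<in> borel_measurable borel" unfolding F_def by measurable
    have "(\<integral>\<^sup>+y. ennreal (norm y ^ (2 * n)) * f (sgn y) \<partial>std_gaussian) = (\<integral>\<^sup>+y. F (norm y) * f (sgn y) \<partial>lborel)"
      unfolding std_gaussian_def
    proof (subst nn_integral_density)
      show "(\<integral>\<^sup>+y. ennreal (exp (- (norm y)\<^sup>2 / 2) / sqrt (2 * pi) ^ ?D) * (ennreal (norm y ^ (2 * n)) * f (sgn y)) \<partial>lborel)
          = (\<integral>\<^sup>+y. F (norm y) * f (sgn y) \<partial>lborel)"
        unfolding F_def by (intro nn_integral_cong, subst ennreal_mult) (auto simp: mult_ac)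
    qed auto
    also have "\<dots> = (\<integral>\<^sup>+u. f u \<partial>sphere_uniform) *
        (\<integral>\<^sup>+r. F r * ennreal (real ?D * v * r ^ (?D - 1)) * indicator {0..} r \<partial>lborel)"
      unfolding v_def by (rule nn_integral_polar) (use fin in auto)
    also have "(\<integral>\<^sup>+r. F r * ennreal (real ?D * v * r ^ (?D - 1)) * indicator {0..} r \<partial>lborel)
        = (\<integral>\<^sup>+r. ennreal (real ?D * v / sqrt (2 * pi) ^ ?D) *
            (ennreal (r ^ (2 * n + ?D - 1) * exp (- (1 / sqrt 2 * r)\<^sup>2)) * indicator {0..} r) \<partial>lborel)"
    proof (intro nn_integral_cong)
      fix r :: real
      have *: "2 * n + ?D - 1 = 2 * n + (?D - 1)" using DIM_positive[where 'a = 'a] by simp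
      show "F r * ennreal (real ?D * v * r ^ (?D - 1)) * indicator {0..} r
          = ennreal (real ?D * v / sqrt (2 * pi) ^ ?D) *
            (ennreal (r ^ (2 * n + ?D - 1) * exp (- (1 / sqrt 2 * r)\<^sup>2)) * indicator {0..} r)"
        unfolding * power_add
        by (auto simp: indicator_def F_def v_def power_divide ennreal_mult[symmetric] mult_ac)
    qed
    also have "\<dots> = ennreal (real ?D * v / sqrt (2 * pi) ^ ?D) *
        ennreal (Gamma ((real (2 * n + ?D - 1) + 1) / 2) / (2 * (1 / sqrt 2) ^ Suc (2 * n + ?D - 1)))"
      by (subst nn_integral_cmult, measurable, subst nn_integral_power_exp_square) auto
    also have "\<dots> = ennreal (c * 2 ^ n * Gamma (real n + real ?D / 2))"
    proof -
      have Suc_q: "Suc (2 * n + ?D - 1) = 2 * n + ?D" using DIM_positive[where 'a = 'a] by simp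
      then have "real (2 * n + ?D - 1) + 1 = real (2 * n + ?D)" by (metis add.commute of_nat_Suc)
      then have q: "(real (2 * n + ?D - 1) + 1) / 2 = real n + real ?D / 2"
        by (simp only: of_nat_add of_nat_mult) (simp add: add_divide_distrib)
      have p: "sqrt 2 ^ (2 * n + ?D) = 2 ^ n * sqrt 2 ^ ?D"
        by (simp add: power_add power_mult)
      show ?thesis
        unfolding q Suc_q power_one_over p by (subst ennreal_mult'[symmetric]) (auto simp: c_def v_def mult_ac)
    qed
    finally show ?thesis .
  qed
  have "1 = c * Gamma (real ?D / 2)"
  proof -
    have mass: "emeasure (std_gaussian :: 'a measure) UNIV = 1" "emeasure (sphere_uniform :: 'a measure) UNIV = 1"
      using prob_space.emeasure_space_1[OF prob_space_std_gaussian]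
        prob_space.emeasure_space_1[OF prob_space_sphere_uniform] by simp_all
    then have "ennreal 1 = ennreal (c * Gamma (real ?D / 2))"
      using radial[of "\<lambda>_. 1" 0] by (simp add: mass)
    then show ?thesis
      using c DIM_positive[where 'a = 'a] by (subst (asm) ennreal_inj) auto
  qed
  moreover have "Gamma (real ?D / 2) > 0" using DIM_positive[where 'a = 'a] by (intro Gamma_real_pos) simp
  ultimately have "c = 1 / Gamma (real ?D / 2)" by (metis less_irrefl nonzero_eq_divide_eq)
  then show ?thesis
    using radial[OF f fin, of n] by simp
qed

lemma AE_sphere_uniform_inner_neq:
  fixes a :: "'a::euclidean_space"
  assumes "a \<noteq> 0"
  shows "AE u in sphere_uniform. a \<bullet> u \<noteq> 0"
proof -
  have "AE y in uniform_measure lborel (ball 0 1). a \<bullet> y \<noteq> 0"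
    using AE_lborel_inner_neq[OF assms] by (intro AE_uniform_measureI) auto
  then have "AE y in uniform_measure lborel (ball 0 1). a \<bullet> sgn y \<noteq> 0"
    by eventually_elim (auto simp: sgn_div_norm)
  then show ?thesis
    unfolding sphere_uniform_def by (subst AE_distr_iff) simp_all
qed

text \<open>
  Cauchy-Schwarz applied to \<open>u \<bullet> log_gradient J a w u = 1\<close>.
\<close>
lemma AE_sphere_uniform_inverse_norm_le_1:
  fixes a :: "'i \<Rightarrow> 'a::euclidean_space"
  assumes J: "finite J" and w: "sum w J = 1" and a: "\<And>j. j \<in> J \<Longrightarrow> a j \<noteq> 0"
  shows "AE u in sphere_uniform. 1 / (norm (log_gradient J a w u))\<^sup>2 \<le> 1"
proof -
  have "AE u in sphere_uniform. \<forall>j\<in>J. a j \<bullet> u \<noteq> 0"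
    using J a by (intro AE_finite_allI AE_sphere_uniform_inner_neq) auto
  then show ?thesis
    using AE_sphere_uniform
  proof eventually_elim
    case (elim u)
    then have "1 = u \<bullet> log_gradient J a w u"
      using inner_self_log_gradient[OF w, of a u] by simp
    also have "\<dots> \<le> norm u * norm (log_gradient J a w u)"
      by (rule norm_cauchy_schwarz)
    finally have "1 \<le> norm (log_gradient J a w u)"
      using elim by simp
    then show ?case
      using one_le_power[of "norm (log_gradient J a w u)" 2] by (simp add: divide_le_eq_1)
  qed
qed

text \<open>
  The function \<open>1 / (norm (log_gradient J a w y))\<^sup>2\<close> is homogeneous of degree two, so its Gaussian moments are
  its moments on the sphere times those of \<open>(norm y)\<^sup>2\<close>.
\<close>
lemma sphere_moment_inverse_norm_log_gradient:
  fixes a :: "'i \<Rightarrow> 'a::euclidean_space"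
  assumes J: "finite J" and w: "\<And>j. j \<in> J \<Longrightarrow> 0 \<le> w j" "sum w J = 1"
    and a: "\<And>j. j \<in> J \<Longrightarrow> a j \<noteq> 0"
  shows "(\<integral>\<^sup>+u. ennreal ((1 / (norm (log_gradient J a w u))\<^sup>2) ^ n) \<partial>sphere_uniform)
    = ennreal (Gamma (real n + 1/2) * Gamma (real DIM('a) / 2) / (Gamma (1/2) * Gamma (real n + real DIM('a) / 2)))"
proof -
  let ?D = "DIM('a)"
  interpret S: prob_space "sphere_uniform :: 'a measure" by (rule prob_space_sphere_uniform)
  define f where "f u = ennreal ((1 / (norm (log_gradient J a w u))\<^sup>2) ^ n)" for u
  define K where "K = 2 ^ n * Gamma (real n + real ?D / 2) / Gamma (real ?D / 2)"
  have D: "real ?D / 2 > 0" using DIM_positive[where 'a = 'a] by simp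
  have K: "K > 0" using D by (auto simp: K_def intro!: divide_pos_pos mult_pos_pos Gamma_real_pos add_nonneg_pos)
  have f [measurable]: "f \<in> borel_measurable borel" unfolding f_def by measurable
  have "AE u in sphere_uniform. 1 / (norm (log_gradient J a w u))\<^sup>2 \<le> 1"
    using J w(2) a by (rule AE_sphere_uniform_inverse_norm_le_1)
  then have "(\<integral>\<^sup>+u. f u \<partial>sphere_uniform) \<le> (\<integral>\<^sup>+u. 1 \<partial>(sphere_uniform :: 'a measure))"
    by (intro nn_integral_mono_AE, eventually_elim) (auto simp: f_def intro!: power_le_one)
  also have "\<dots> = 1" using S.emeasure_space_1 by simp
  finally have fin: "(\<integral>\<^sup>+u. f u \<partial>sphere_uniform) < \<infinity>"
    by (rule le_less_trans) simp
  have hom: "log_gradient J a w (sgn y) = norm y *\<^sub>R log_gradient J a w y" for y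
    by (simp add: log_gradient_def sgn_div_norm scaleR_sum_right mult_ac)
  have "f y = ennreal (norm y ^ (2 * n)) * f (sgn y)" if "y \<noteq> 0" for y
    using that by (simp add: f_def hom ennreal_mult'[symmetric] power_mult_distrib power_divide power_mult)
  moreover have "AE y in std_gaussian. y \<noteq> (0 :: 'a)"
    unfolding std_gaussian_def using AE_lborel_singleton[of 0] by (subst AE_density) auto
  ultimately have "(\<integral>\<^sup>+y. f y \<partial>std_gaussian) = (\<integral>\<^sup>+y. ennreal (norm y ^ (2 * n)) * f (sgn y) \<partial>std_gaussian)"
    by (intro nn_integral_cong_AE) auto
  also have "\<dots> = (\<integral>\<^sup>+u. f u \<partial>sphere_uniform) * ennreal K"
    unfolding K_def by (rule gaussian_homogeneous_moment[OF f fin])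
  finally have "(\<integral>\<^sup>+u. f u \<partial>sphere_uniform) * ennreal K = ennreal (2 ^ n * Gamma (real n + 1/2) / Gamma (1/2))"
    using gaussian_moment_inverse_norm_log_gradient[OF J w a, where n = n] by (simp add: f_def)
  then have "(\<integral>\<^sup>+u. f u \<partial>sphere_uniform) * ennreal K * ennreal (1 / K)
      = ennreal (2 ^ n * Gamma (real n + 1/2) / Gamma (1/2)) * ennreal (1 / K)" by simp
  also have "(\<integral>\<^sup>+u. f u \<partial>sphere_uniform) * ennreal K * ennreal (1 / K) = (\<integral>\<^sup>+u. f u \<partial>sphere_uniform)"
    using K by (simp add: mult.assoc ennreal_mult'[symmetric])
  also have "ennreal (2 ^ n * Gamma (real n + 1/2) / Gamma (1/2)) * ennreal (1 / K)
      = ennreal (Gamma (real n + 1/2) * Gamma (real ?D / 2) / (Gamma (1/2) * Gamma (real n + real ?D / 2)))"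
  proof -
    have "0 \<le> 1 / K" using K by simp
    then show ?thesis by (subst ennreal_mult''[symmetric]) (assumption, simp add: K_def)
  qed
  finally show ?thesis by (simp add: f_def)
qed

section \<open>Distributions on the unit interval and their moments\<close>

text \<open>
  The exponential series may be integrated term by term because its terms are dominated by those
  of \<open>exp \<bar>t\<bar>\<close>.
\<close>
lemma char_moment_series:
  assumes M: "real_distribution M" and bound: "AE x in M. \<bar>x\<bar> \<le> 1"
  shows "char M t = (\<Sum>n. (\<i> * of_real t) ^ n / fact n * of_real (\<integral>x. x ^ n \<partial>M))"
proof -
  interpret real_distribution M by (rule M)
  let ?f = "\<lambda>n x. (\<i> * of_real t) ^ n / fact n * of_real (x ^ n) :: complex"
  have norm: "norm (?f n x) = \<bar>t\<bar> ^ n / fact n * \<bar>x\<bar> ^ n" for n x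
    by (simp add: norm_mult norm_divide norm_power power_abs)
  have sums: "(\<lambda>n. \<bar>t\<bar> ^ n / fact n * \<bar>x\<bar> ^ n) sums exp (\<bar>t\<bar> * \<bar>x\<bar>)" for x
    using exp_converges[of "\<bar>t\<bar> * \<bar>x\<bar>"] by (simp add: scaleR_conv_of_real power_mult_distrib divide_inverse mult_ac)
  have le: "AE x in M. norm (?f n x) \<le> \<bar>t\<bar> ^ n / fact n" for n
    using bound unfolding norm by eventually_elim (auto intro!: divide_right_mono mult_left_le power_le_one)
  have int: "integrable M (?f n)" for n
    by (rule integrable_const_bound[OF le]) auto
  have "iexp (t * x) = (\<Sum>n. ?f n x)" for x
    by (simp add: exp_def scaleR_conv_of_real power_mult_distrib divide_inverse mult_ac)
  then have "char M t = (\<integral>x. (\<Sum>n. ?f n x) \<partial>M)"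
    by (simp add: char_def)
  also have "\<dots> = (\<Sum>n. integral\<^sup>L M (?f n))"
  proof (rule integral_suminf[OF int])
    show "AE x in M. summable (\<lambda>n. norm (?f n x))"
      unfolding norm using sums by (auto intro: sums_summable)
    show "summable (\<lambda>n. \<integral>x. norm (?f n x) \<partial>M)"
    proof (rule summable_comparison_test')
      show "summable (\<lambda>n. \<bar>t\<bar> ^ n / fact n)"
        using sums[of 1] by (auto intro: sums_summable)
      show "norm (\<integral>x. norm (?f n x) \<partial>M) \<le> \<bar>t\<bar> ^ n / fact n" for n
      proof -
        have "(\<integral>x. norm (?f n x) \<partial>M) \<le> (\<integral>x. \<bar>t\<bar> ^ n / fact n \<partial>M)"
          using le int by (intro integral_mono_AE) auto
        then show ?thesis by (simp add: prob_space[simplified])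
      qed
    qed
  qed
  also have "\<dots> = (\<Sum>n. (\<i> * of_real t) ^ n / fact n * of_real (\<integral>x. x ^ n \<partial>M))"
    by (simp del: of_real_power)
  finally show ?thesis .
qed

text \<open>
  The moments determine the characteristic function.
\<close>
lemma real_distribution_eq_if_moments_eq:
  assumes M: "real_distribution M" "AE x in M. 0 \<le> x \<and> x \<le> 1"
    and N: "real_distribution N" "AE x in N. 0 \<le> x \<and> x \<le> 1"
    and eq: "\<And>n. (\<integral>\<^sup>+x. ennreal (x ^ n) \<partial>M) = (\<integral>\<^sup>+x. ennreal (x ^ n) \<partial>N)"
  shows "M = N"
proof (rule Levy_uniqueness[OF M(1) N(1)])
  interpret M: real_distribution M by (rule M)
  interpret N: real_distribution N by (rule N)
  have "(\<integral>x. x ^ n \<partial>M) = (\<integral>x. x ^ n \<partial>N)" for n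
  proof -
    have "AE x in M. 0 \<le> x ^ n" using M(2) by eventually_elim simp
    moreover have "AE x in N. 0 \<le> x ^ n" using N(2) by eventually_elim simp
    ultimately show ?thesis
      by (simp add: integral_eq_nn_integral eq)
  qed
  moreover have "AE x in M. \<bar>x\<bar> \<le> 1" using M(2) by eventually_elim simp
  moreover have "AE x in N. \<bar>x\<bar> \<le> 1" using N(2) by eventually_elim simp
  ultimately show "char M = char N"
    using M(1) N(1) by (auto simp: char_moment_series)
qed

lemma measurable_beta_density [measurable]: "beta_density \<alpha> \<beta> \<in> borel_measurable borel"
  unfolding beta_density_def[abs_def] by measurable

lemma Beta_real_pos: "0 < \<alpha> \<Longrightarrow> 0 < \<beta> \<Longrightarrow> 0 < Beta \<alpha> (\<beta> :: real)"
  by (auto simp: Beta_def intro!: divide_pos_pos mult_pos_pos Gamma_real_pos)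

lemma nn_integral_beta_density_power:
  assumes "0 < \<alpha>" "0 < \<beta>"
  shows "(\<integral>\<^sup>+x. ennreal (beta_density \<alpha> \<beta> x) * ennreal (x ^ n) \<partial>lborel) = ennreal (Beta (\<alpha> + n) \<beta> / Beta \<alpha> \<beta>)"
proof -
  define h where "h x = (if x \<in> {0<..<1} then x powr (\<alpha> + n - 1) * (1 - x) powr (\<beta> - 1) / Beta \<alpha> \<beta> else 0)" for x :: real
  have "((\<lambda>x. x powr (\<alpha> + n - 1) * (1 - x) powr (\<beta> - 1)) has_integral Beta (\<alpha> + n) \<beta>) {0<..<1}"
    using has_integral_Beta_real[of "\<alpha> + n" \<beta>] assms by (simp add: has_integral_Icc_iff_Ioo)
  then have "(h has_integral Beta (\<alpha> + n) \<beta> / Beta \<alpha> \<beta>) UNIV"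
    unfolding h_def has_integral_restrict_UNIV by (rule has_integral_divide)
  then have "(\<integral>\<^sup>+x. ennreal (h x) \<partial>lborel) = ennreal (Beta (\<alpha> + n) \<beta> / Beta \<alpha> \<beta>)"
    using Beta_real_pos[OF assms] by (intro nn_integral_has_integral_lborel) (auto simp: h_def[abs_def])
  moreover have "ennreal (beta_density \<alpha> \<beta> x) * ennreal (x ^ n) = ennreal (h x)" for x
    using Beta_real_pos[OF assms]
    by (auto simp: beta_density_def h_def ennreal_mult[symmetric] powr_realpow[symmetric] powr_add[symmetric] algebra_simps)
  ultimately show ?thesis by simp
qed

lemma real_distribution_beta_density:
  assumes "0 < \<alpha>" "0 < \<beta>"
  shows "real_distribution (density lborel (beta_density \<alpha> \<beta>))"
proof -
  have "prob_space (density lborel (beta_density \<alpha> \<beta>))"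
    using nn_integral_beta_density_power[OF assms, of 0] Beta_real_pos[OF assms]
    by (intro prob_spaceI) (simp add: emeasure_density)
  then show ?thesis
    by (simp add: real_distribution_def real_distribution_axioms_def)
qed

section \<open>The law on the sphere\<close>

text \<open>
  The \<open>n\<close>-th moments of both sides are the quotient of \<open>Beta (1/2 + n) \<beta>\<close> and \<open>Beta (1/2) \<beta>\<close>, where
  \<open>\<beta> = (real DIM('a) - 1) / 2\<close>.
\<close>
theorem distr_inverse_norm_log_gradient:
  fixes a :: "'i \<Rightarrow> 'a::euclidean_space"
  assumes dim: "2 \<le> DIM('a)"
    and J: "finite J" and w: "\<And>j. j \<in> J \<Longrightarrow> 0 \<le> w j" "sum w J = 1"
    and a: "\<And>j. j \<in> J \<Longrightarrow> a j \<noteq> 0"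
  shows "distr sphere_uniform borel (\<lambda>u. 1 / (norm (log_gradient J a w u))\<^sup>2)
    = density lborel (beta_density (1/2) ((real DIM('a) - 1) / 2))"
proof (rule real_distribution_eq_if_moments_eq)
  interpret S: prob_space "sphere_uniform :: 'a measure" by (rule prob_space_sphere_uniform)
  define \<beta> where "\<beta> = (real DIM('a) - 1) / 2"
  have \<beta>: "0 < \<beta>" using dim by (simp add: \<beta>_def)
  let ?h = "\<lambda>u. 1 / (norm (log_gradient J a w u))\<^sup>2"
  show "real_distribution (distr sphere_uniform borel ?h)"
    by (simp add: real_distribution_def real_distribution_axioms_def S.prob_space_distr)
  show "AE x in distr sphere_uniform borel ?h. 0 \<le> x \<and> x \<le> 1"
    using AE_sphere_uniform_inverse_norm_le_1[OF J w(2) a] by (subst AE_distr_iff) auto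
  show "real_distribution (density lborel (\<lambda>x. ennreal (beta_density (1/2) ((real DIM('a) - 1) / 2) x)))"
    unfolding \<beta>_def[symmetric] by (rule real_distribution_beta_density) (use \<beta> in auto)
  show "AE x in density lborel (\<lambda>x. ennreal (beta_density (1/2) ((real DIM('a) - 1) / 2) x)). 0 \<le> x \<and> x \<le> 1"
    by (subst AE_density) (auto simp: beta_density_def)
  show "(\<integral>\<^sup>+x. ennreal (x ^ n) \<partial>distr sphere_uniform borel ?h)
      = (\<integral>\<^sup>+x. ennreal (x ^ n) \<partial>density lborel (\<lambda>x. ennreal (beta_density (1/2) ((real DIM('a) - 1) / 2) x)))" for n
  proof -
    have "(\<integral>\<^sup>+x. ennreal (x ^ n) \<partial>distr sphere_uniform borel ?h)
        = ennreal (Gamma (real n + 1/2) * Gamma (real DIM('a) / 2) / (Gamma (1/2) * Gamma (real n + real DIM('a) / 2)))"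
      using sphere_moment_inverse_norm_log_gradient[OF J w a, where n = n] by (simp add: nn_integral_distr)
    also have "Gamma (real n + 1/2) * Gamma (real DIM('a) / 2) / (Gamma (1/2) * Gamma (real n + real DIM('a) / 2))
        = Beta (1/2 + n) \<beta> / Beta (1/2) \<beta>"
    proof -
      have sums: "1/2 + \<beta> = real DIM('a) / 2" "1/2 + real n + \<beta> = real n + real DIM('a) / 2"
        by (simp_all add: \<beta>_def field_simps)
      moreover have "Gamma \<beta> \<noteq> 0" using Gamma_real_pos[OF \<beta>] by simp
      ultimately show ?thesis
        unfolding Beta_def sums by (simp add: add.commute[of "1/2"] mult.commute)
    qed
    also have "ennreal \<dots> = (\<integral>\<^sup>+x. ennreal (beta_density (1/2) \<beta> x) * ennreal (x ^ n) \<partial>lborel)"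
      by (rule nn_integral_beta_density_power[symmetric]) (use \<beta> in auto)
    also have "\<dots> = (\<integral>\<^sup>+x. ennreal (x ^ n) \<partial>density lborel (\<lambda>x. ennreal (beta_density (1/2) \<beta> x)))"
      by (subst nn_integral_density) auto
    finally show ?thesis by (simp add: \<beta>_def)
  qed
qed

theorem theorem2p1:
  fixes M :: "'s measure"
    and U :: "'s \<Rightarrow> real ^ 'n"
    and k :: nat
    and a :: "nat \<Rightarrow> real ^ 'n"
    and w :: "nat \<Rightarrow> real"
  assumes "CARD('n) \<ge> 2"
    and "prob_space M"
    and "U \<in> borel_measurable M"
    and "distr M borel U = sphere_uniform"
    and "\<And>j. j \<in> {1..k} \<Longrightarrow> a j \<noteq> 0"
    and "\<And>j. j \<in> {1..k} \<Longrightarrow> w j \<ge> 0"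
    and "(\<Sum>j\<in>{1..k}. w j) = 1"
  shows "(AE s in M. U s \<notin> exceptional_set k a w
             \<and> H_fun k a w (U s) = (U s \<bullet> N_field k a w (U s))\<^sup>2)
    \<and> distributed M lborel (\<lambda>s. H_fun k a w (U s)) (beta_density (1/2) ((real CARD('n) - 1) / 2))
    \<and> (\<forall>(l::nat) (b :: nat \<Rightarrow> real ^ 'n) (v :: nat \<Rightarrow> real).
          (\<forall>j\<in>{1..l}. b j \<noteq> 0 \<and> v j \<ge> 0) \<and> (\<Sum>j\<in>{1..l}. v j) = 1 \<longrightarrow>
          distr M borel (\<lambda>s. H_fun l b v (U s)) = distr M borel (\<lambda>s. H_fun k a w (U s)))"
proof -
  note [measurable] = assms(3)
  let ?J = "\<lambda>l v. {j\<in>{1..l}. (v j :: real) > 0}"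
  have g: "g_field l b v = log_gradient (?J l v) b v" for l and b :: "nat \<Rightarrow> real ^ 'n" and v
    by (simp add: fun_eq_iff g_field_def log_gradient_def)
  have sum_J: "sum v (?J l v) = 1" if "\<And>j. j \<in> {1..l} \<Longrightarrow> v j \<ge> 0" "(\<Sum>j\<in>{1..l}. v j) = 1" for l :: nat and v
  proof -
    have "sum v (?J l v) = sum v {1..l}"
      using that(1) by (intro sum.mono_neutral_left) (auto simp: not_less intro: antisym)
    then show ?thesis using that(2) by simp
  qed
  have [measurable]: "H_fun l b v \<in> borel_measurable borel" for l and b :: "nat \<Rightarrow> real ^ 'n" and v
    unfolding H_fun_def[abs_def] g by measurable
  have law: "distr M borel (\<lambda>s. H_fun l b v (U s))
      = density lborel (beta_density (1/2) ((real CARD('n) - 1) / 2))"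
    if "\<And>j. j \<in> {1..l} \<Longrightarrow> b j \<noteq> 0" "\<And>j. j \<in> {1..l} \<Longrightarrow> v j \<ge> 0" "(\<Sum>j\<in>{1..l}. v j) = 1"
    for l and b :: "nat \<Rightarrow> real ^ 'n" and v
  proof -
    have "distr M borel (\<lambda>s. H_fun l b v (U s)) = distr (distr M borel U) borel (H_fun l b v)"
      by (subst distr_distr) (auto simp: comp_def)
    also have "\<dots> = distr sphere_uniform borel (\<lambda>u. 1 / (norm (log_gradient (?J l v) b v u))\<^sup>2)"
      by (simp add: assms(4) H_fun_def[abs_def] g)
    also have "\<dots> = density lborel (beta_density (1/2) ((real DIM(real ^ 'n) - 1) / 2))"
      using assms(1) that sum_J[of l v] by (intro distr_inverse_norm_log_gradient) auto
    finally show ?thesis by simp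
  qed
  have "AE u in distr M borel U. \<forall>j\<in>?J k w. a j \<bullet> u \<noteq> 0"
    unfolding assms(4) using assms(5) by (intro AE_finite_allI AE_sphere_uniform_inner_neq) auto
  then have "AE s in M. \<forall>j\<in>?J k w. a j \<bullet> U s \<noteq> 0"
    by (subst (asm) AE_distr_iff) auto
  then have "AE s in M. U s \<notin> exceptional_set k a w
      \<and> H_fun k a w (U s) = (U s \<bullet> N_field k a w (U s))\<^sup>2"
  proof eventually_elim
    case (elim s)
    then have "U s \<bullet> g_field k a w (U s) = 1"
      unfolding g using sum_J[of k w] assms(6,7) by (intro inner_self_log_gradient) auto
    then have "H_fun k a w (U s) = (U s \<bullet> N_field k a w (U s))\<^sup>2"
      by (simp add: H_fun_def N_field_def inverse_eq_divide power_divide)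
    then show ?case using elim by (auto simp: exceptional_set_def)
  qed
  moreover have "distributed M lborel (\<lambda>s. H_fun k a w (U s)) (beta_density (1/2) ((real CARD('n) - 1) / 2))"
    unfolding distributed_def
  proof (intro conjI)
    have "distr M lborel (\<lambda>s. H_fun k a w (U s)) = distr M borel (\<lambda>s. H_fun k a w (U s))"
      by (rule distr_cong) auto
    then show "distr M lborel (\<lambda>s. H_fun k a w (U s)) = density lborel (beta_density (1/2) ((real CARD('n) - 1) / 2))"
      using law[OF assms(5-7)] by simp
  qed auto
  moreover have "distr M borel (\<lambda>s. H_fun l b v (U s)) = distr M borel (\<lambda>s. H_fun k a w (U s))"
    if "(\<forall>j\<in>{1..l}. b j \<noteq> 0 \<and> v j \<ge> 0) \<and> (\<Sum>j\<in>{1..l}. v j) = 1"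
    for l and b :: "nat \<Rightarrow> real ^ 'n" and v
  proof -
    have "distr M borel (\<lambda>s. H_fun l b v (U s)) = density lborel (beta_density (1/2) ((real CARD('n) - 1) / 2))"
      by (rule law) (use that in auto)
    also have "\<dots> = distr M borel (\<lambda>s. H_fun k a w (U s))"
      by (rule law[OF assms(5-7), symmetric])
    finally show ?thesis .
  qed
  ultimately show ?thesis by blast
qed

end
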